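(* Let $c<d$ be real numbers, let $\alpha,\beta,\gamma,\delta,\omega_1,\omega_2\in\mathbb{C}$ with $\mathrm{Re}(\alpha),\mathrm{Re}(\beta),\mathrm{Re}(\gamma)>0$, and let $n:=\lfloor\mathrm{Re}(\gamma)\rfloor+1$. Then: (1) for $f\in L^1(c,d)$, $${}_c\mathfrak{D}_{\alpha,\beta,\gamma}^{\delta;\omega_1,\omega_2}\,{}_c\mathfrak{I}_{\alpha,\beta,\gamma}^{\delta;\omega_1,\omega_2}f(x)=f(x);$$ (2) for $f\in C^n(c,d)$ with $f^{(n)}\in L^1(c,d)$, $${}_c\mathfrak{I}_{\alpha,\beta,\gamma}^{\delta;\omega_1,\omega_2}\,{}_c\mathfrak{C}_{\alpha,\beta,\gamma}^{\delta;\omega_1,\omega_2}f(x)=\left(\int_c^x\right)^n\left(\frac{\mathrm{d}}{\mathrm{d}x}\right)^nf(x)=f(x)-\sum_{k=0}^{n-1}\frac{(x-c)^kf^{(k)}(c)}{k!},$$ where $\left(\int_c^x\right)^n$ denotes $n$-fold repeated integration from $c$.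
   Context: For $\alpha,\beta,\gamma,\delta\in\mathbb{C}$ with $\mathrm{Re}(\alpha)>0$, $\mathrm{Re}(\beta)>0$ and $x,y\in\mathbb{C}$, the bivariate Mittag-Leffler function is $$E_{\alpha,\beta,\gamma}^{\delta}(x,y)=\sum_{k=0}^{\infty}\sum_{l=0}^{\infty}\frac{(\delta)_{k+l}}{\Gamma(\alpha k+\beta l+\gamma)}\cdot\frac{x^ky^l}{k!\,l!}$$ (the double series converges absolutely), where $(a)_n=a(a+1)\cdots(a+n-1)$, $(a)_0=1$, is the Pochhammer symbol. For $\mathrm{Re}(\alpha),\mathrm{Re}(\beta),\mathrm{Re}(\gamma)>0$ and $f\in L^1(c,d)$, the fractional integral operator is $$\Big({}_c\mathfrak{I}_{\alpha,\beta,\gamma}^{\delta;\omega_1,\omega_2}f\Big)(x)=\int_c^x(x-\xi)^{\gamma-1}E_{\alpha,\beta,\gamma}^{\delta}\left(\omega_1(x-\xi)^{\alpha},\omega_2(x-\xi)^{\beta}\right)f(\xi)\,\mathrm{d}\xi.$$ With $n:=\lfloor\mathrm{Re}(\gamma)\rfloor+1$, the derivative operators of Riemann--Liouville type and Caputo type are respectively $$\left({}_c\mathfrak{D}_{\alpha,\beta,\gamma}^{\delta;\omega_1,\omega_2}f\right)(x)=\frac{\mathrm{d}^n}{\mathrm{d}x^n}\left({}_c\mathfrak{I}_{\alpha,\beta,n-\gamma}^{-\delta;\omega_1,\omega_2}f(x)\right),\qquad\left({}_c\mathfrak{C}_{\alpha,\beta,\gamma}^{\delta;\omega_1,\omega_2}f\right)(x)={}_c\mathfrak{I}_{\alpha,\beta,n-\gamma}^{-\delta;\omega_1,\omega_2}\left(f^{(n)}\right)(x).$$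 Complex powers of positive reals are principal; identities between $L^1$ functions are understood for almost every $x\in(c,d)$; $f^{(k)}(c)$ denotes the limit of $f^{(k)}(x)$ as $x\to c^+$ (which exists for $k<n$ when $f^{(n)}\in L^1(c,d)$). *)

theory Defs
  imports "HOL-Analysis.Analysis"
begin

(* Isabelle sets Gamma z = 0 at the poles z = 0, -1, -2, ... and a / 0 = 0, which agrees with the
   usual convention 1 / Gamma z = 0 there. *)
definition mittag_leffler2 ::
  "complex \<Rightarrow> complex \<Rightarrow> complex \<Rightarrow> complex \<Rightarrow> complex \<Rightarrow> complex \<Rightarrow> complex" where
  "mittag_leffler2 \<alpha> \<beta> \<gamma> \<delta> x y =
     (\<Sum>k. \<Sum>l. pochhammer \<delta> (k + l) / Gamma (\<alpha> * of_nat k + \<beta> * of_nat l + \<gamma>)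
                 * (x ^ k * y ^ l / (fact k * fact l)))"

definition ml_integral ::
  "real \<Rightarrow> complex \<Rightarrow> complex \<Rightarrow> complex \<Rightarrow> complex \<Rightarrow> complex \<Rightarrow> complex
    \<Rightarrow> (real \<Rightarrow> complex) \<Rightarrow> real \<Rightarrow> complex" where
  "ml_integral c \<alpha> \<beta> \<gamma> \<delta> \<omega>1 \<omega>2 f x =
     (LINT \<xi>:{c<..<x}|lebesgue.
        of_real (x - \<xi>) powr (\<gamma> - 1)
        * mittag_leffler2 \<alpha> \<beta> \<gamma> \<delta> (\<omega>1 * of_real (x - \<xi>) powr \<alpha>) (\<omega>2 * of_real (x - \<xi>) powr \<beta>)
        * f \<xi>)"

definition nth_deriv :: "nat \<Rightarrow> (real \<Rightarrow> complex) \<Rightarrow> real \<Rightarrow> complex" where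
  "nth_deriv n = (\<lambda>g x. vector_derivative g (at x)) ^^ n"

(* nth_deriv is total, with an unspecified value where the derivative does not exist; this
   predicate says that the n-th derivative at x genuinely exists. *)
primrec nth_differentiable_at :: "nat \<Rightarrow> (real \<Rightarrow> complex) \<Rightarrow> real \<Rightarrow> bool" where
  "nth_differentiable_at 0 f x \<longleftrightarrow> True"
| "nth_differentiable_at (Suc n) f x \<longleftrightarrow>
     (\<forall>\<^sub>F t in nhds x. nth_differentiable_at n f t) \<and> nth_deriv n f differentiable (at x)"

definition C_n_on :: "nat \<Rightarrow> (real \<Rightarrow> complex) \<Rightarrow> real set \<Rightarrow> bool" where
  "C_n_on n f S \<longleftrightarrow>
     (\<forall>x\<in>S. nth_differentiable_at n f x) \<and> continuous_on S (nth_deriv n f)"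

definition frac_order :: "complex \<Rightarrow> nat" where
  "frac_order \<gamma> = nat (\<lfloor>Re \<gamma>\<rfloor> + 1)"

definition ml_deriv_RL ::
  "real \<Rightarrow> complex \<Rightarrow> complex \<Rightarrow> complex \<Rightarrow> complex \<Rightarrow> complex \<Rightarrow> complex
    \<Rightarrow> (real \<Rightarrow> complex) \<Rightarrow> real \<Rightarrow> complex" where
  "ml_deriv_RL c \<alpha> \<beta> \<gamma> \<delta> \<omega>1 \<omega>2 f =
     nth_deriv (frac_order \<gamma>)
       (ml_integral c \<alpha> \<beta> (of_nat (frac_order \<gamma>) - \<gamma>) (- \<delta>) \<omega>1 \<omega>2 f)"

(* Existence of the outer derivative in ml_deriv_RL at x. *)
definition ml_deriv_RL_exists ::
  "real \<Rightarrow> complex \<Rightarrow> complex \<Rightarrow> complex \<Rightarrow> complex \<Rightarrow> complex \<Rightarrow> complex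
    \<Rightarrow> (real \<Rightarrow> complex) \<Rightarrow> real \<Rightarrow> bool" where
  "ml_deriv_RL_exists c \<alpha> \<beta> \<gamma> \<delta> \<omega>1 \<omega>2 f x \<longleftrightarrow>
     nth_differentiable_at (frac_order \<gamma>)
       (ml_integral c \<alpha> \<beta> (of_nat (frac_order \<gamma>) - \<gamma>) (- \<delta>) \<omega>1 \<omega>2 f) x"

definition ml_deriv_Caputo ::
  "real \<Rightarrow> complex \<Rightarrow> complex \<Rightarrow> complex \<Rightarrow> complex \<Rightarrow> complex \<Rightarrow> complex
    \<Rightarrow> (real \<Rightarrow> complex) \<Rightarrow> real \<Rightarrow> complex" where
  "ml_deriv_Caputo c \<alpha> \<beta> \<gamma> \<delta> \<omega>1 \<omega>2 f =
     ml_integral c \<alpha> \<beta> (of_nat (frac_order \<gamma>) - \<gamma>) (- \<delta>) \<omega>1 \<omega>2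
       (nth_deriv (frac_order \<gamma>) f)"

definition iterated_integral :: "real \<Rightarrow> nat \<Rightarrow> (real \<Rightarrow> complex) \<Rightarrow> real \<Rightarrow> complex" where
  "iterated_integral c n = (\<lambda>g x. LINT t:{c<..<x}|lebesgue. g t) ^^ n"

end

theory Submission
  imports Defs
begin

text \<open>
Write \<open>K(\<gamma>, \<delta>)\<close> for the function \<open>t^(\<gamma> - 1) E(\<omega>1 t^\<alpha>, \<omega>2 t^\<beta>)\<close> of \<open>t > 0\<close>, extended by zero.
The fractional integral is convolution with \<open>K(\<gamma>, \<delta>)\<close>, and both inversion formulas come from one
fact: these kernels form a two-parameter convolution semigroup,
\<open>K(\<gamma>, \<delta>) * K(\<gamma>', \<delta>') = K(\<gamma> + \<gamma>', \<delta> + \<delta>')\<close> (theorem \<open>convolution_ml_kernel\<close>). With \<open>\<delta>' = -\<delta>\<close>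
and \<open>\<gamma>' = n - \<gamma>\<close> the product is \<open>K(n, 0)\<close>, which is \<open>t^(n - 1) / (n - 1)!\<close>, the kernel of n-fold
repeated integration from \<open>c\<close>. Hence both composed fractional integrals equal n-fold integration, of
\<open>f\<close> in the first formula and of its n-th derivative in the second.

Why the semigroup law holds: \<open>K(\<gamma>, \<delta>)\<close> is a double series of the Riemann-Liouville kernels
\<open>h(z) = t^(z - 1) / \<Gamma>(z)\<close> with \<open>z = \<alpha>k + \<beta>l + \<gamma>\<close>. Euler's Beta integral says
\<open>h(z) * h(w) = h(z + w)\<close> (\<open>convolution_rl_kernel\<close>), so convolving two such series amounts to taking
the Cauchy product of their coefficients. The coefficients \<open>pochhammer \<delta> (k + l) / (k! l!)\<close> are those
of the power series of \<open>(1 - x - y)^(-\<delta>)\<close>, and these series multiply by adding the exponents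
(\<open>ml_coeff_convolution\<close>). Termwise convolution is
justified by absolute convergence (\<open>ml_coeff_rGamma_abs_summable\<close>). That rests on a bound for
\<open>1 / \<Gamma>\<close> in a sector around the positive real axis, because \<open>\<alpha>\<close> and \<open>\<beta>\<close> are complex: the numbers
\<open>\<alpha>k + \<beta>l + \<gamma>\<close> stay in such a sector, and there \<open>1 / \<Gamma>(z)\<close> decays faster than every
exponential in \<open>Re z\<close> (\<open>norm_rGamma_sector_le\<close>).

Passing from kernels to operators is associativity of convolution (\<open>convolution_assoc\<close>). Fubini
applies at every single point and not only almost everywhere, since the convolution of the absolute
values of the two kernels is bounded by a multiple of \<open>t^(n - 1)\<close> on bounded intervals, and \<open>n \<ge> 1\<close>.

What remains is calculus. In the first formula, n-1 derivatives undo all integrations but one, and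
the last derivative exists and equals \<open>f\<close> almost everywhere by Lebesgue's differentiation theorem
in one dimension (\<open>indefinite_integral_has_vector_derivative_ae\<close>), proved here from Henstock's lemma
and the Vitali covering theorem. The second formula is Taylor's formula with all boundary
values taken as limits at \<open>c\<close> (\<open>iterated_integral_nth_deriv\<close>).
\<close>

section \<open>Almost everywhere differentiation of indefinite integrals\<close>

text \<open>
Points with a difference quotient that is off by more than \<open>\<epsilon>\<close> at arbitrarily small scales are
covered, in the sense of Vitali, by arbitrarily short intervals on which the Riemann sum term
\<open>f x * length\<close> misses the integral by more than \<open>\<epsilon> * length\<close>. For finitely many disjoint such
intervals Henstock's lemma makes the total error, and therefore the total length, as small as
desired.
\<close>
lemma integral_defect_exceptional_set_negligible:
  fixes f :: "real \<Rightarrow> 'a::euclidean_space"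
  assumes f: "f integrable_on {a..b}" and \<epsilon>: "\<epsilon> > 0"
  shows "negligible {x\<in>{a<..<b}. \<forall>d>0. \<exists>y\<in>{a..b}. y \<noteq> x \<and> \<bar>y - x\<bar> < d \<and>
           \<epsilon> * \<bar>y - x\<bar> < norm (integral {a..y} f - integral {a..x} f - (y - x) *\<^sub>R f x)}"
    (is "negligible ?E")
  unfolding negligible_outer_le
proof (intro allI impI)
  fix e :: real
  assume e: "e > 0"
  define E where "E = ?E"
  have Eab: "x \<in> {a<..<b}" if "x \<in> E" for x
    using that unfolding E_def by blast
  have Edef: "\<exists>y\<in>{a..b}. y \<noteq> x \<and> \<bar>y - x\<bar> < d \<and>
           \<epsilon> * \<bar>y - x\<bar> < norm (integral {a..y} f - integral {a..x} f - (y - x) *\<^sub>R f x)"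
    if "x \<in> E" "d > 0" for x d
    using that(1) that(2) unfolding E_def by blast
  define I where "I = (\<lambda>(x, y). {min x y..max x y} :: real set)"
  obtain \<gamma> where \<gamma>: "gauge \<gamma>" and H: "\<And>p. \<lbrakk>p tagged_partial_division_of (cbox a b); \<gamma> fine p\<rbrakk> \<Longrightarrow>
             sum (\<lambda>(x,k). norm(measure lborel k *\<^sub>R f x - integral k f)) p < e * \<epsilon>"
    using Henstock_lemma[of f a b "e * \<epsilon>"] f e \<epsilon> by (auto simp: cbox_interval)
  \<comment> \<open>The Vitali cover: a bad interval is stored as its tag \<open>x\<close> together with its other endpoint \<open>y\<close>,
     since the tag is needed to form a tagged partial division.\<close>
  define K where "K = {(x, y). x \<in> E \<and> y \<in> {a..b} \<and> y \<noteq> x \<and> I (x, y) \<subseteq> \<gamma> x \<and>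
     \<epsilon> * \<bar>y - x\<bar> < norm (integral {a..y} f - integral {a..x} f - (y - x) *\<^sub>R f x)}"
  \<comment> \<open>The covering theorem speaks of closed balls, so intervals are given by centre and radius.\<close>
  define c r where "c = (\<lambda>(x, y). (x + y) / 2 :: real)" and "r = (\<lambda>(x, y). \<bar>x - y\<bar> / 2 :: real)"
  have cb: "cball (c p) (r p) = I p" for p
  proof -
    obtain x y where p: "p = (x, y)" by (cases p)
    have "(x + y) / 2 - \<bar>x - y\<bar> / 2 = min x y" "(x + y) / 2 + \<bar>x - y\<bar> / 2 = max x y"
      by (simp_all add: min_def max_def abs_if field_simps)
    then show ?thesis by (simp add: p c_def r_def I_def cball_eq_atLeastAtMost)
  qed
  have "0 < r p" if "p \<in> K" for p
    using that unfolding K_def r_def by (simp add: case_prod_beta)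
  moreover have "\<exists>p. p \<in> K \<and> x \<in> cball (c p) (r p) \<and> r p < d" if x: "x \<in> E" and d: "d > 0" for x d
  proof -
    have "x \<in> \<gamma> x" "open (\<gamma> x)" using \<gamma> by (auto simp: gauge_def)
    then obtain \<eta> where \<eta>: "\<eta> > 0" "ball x \<eta> \<subseteq> \<gamma> x" by (meson openE)
    have "min d \<eta> > 0" using d \<eta> by auto
    obtain y where y: "y \<in> {a..b}" "y \<noteq> x" "\<bar>y - x\<bar> < min d \<eta>"
       "\<epsilon> * \<bar>y - x\<bar> < norm (integral {a..y} f - integral {a..x} f - (y - x) *\<^sub>R f x)"
      using Edef[OF x \<open>min d \<eta> > 0\<close>] by blast
    have "I (x, y) \<subseteq> ball x \<eta>" using y(3) by (auto simp: I_def dist_real_def)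
    then have "(x, y) \<in> K" using x y \<eta>(2) by (auto simp: K_def)
    moreover have "x \<in> cball (c (x, y)) (r (x, y))" by (subst cb) (auto simp: I_def)
    moreover have "r (x, y) < d" using y by (auto simp: r_def)
    ultimately show ?thesis by blast
  qed
  ultimately obtain C where C: "countable C" "C \<subseteq> K"
    and disj: "pairwise (\<lambda>i j. disjnt (cball (c i) (r i)) (cball (c j) (r j))) C"
    and neg: "negligible (E - (\<Union>i\<in>C. cball (c i) (r i)))"
    using Vitali_covering_theorem_cballs[of K r E c] by blast
  have bound: "measure lebesgue (\<Union>p\<in>D. I p) \<le> e" if D: "D \<subseteq> C" "finite D" for D
  proof -
    have injD: "inj_on (\<lambda>p. (fst p, I p)) D"
    proof (rule inj_onI, clarsimp)
      fix x y y' assume "I (x, y) = I (x, y')"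
      then have "min x y = min x y'" "max x y = max x y'" by (auto simp: I_def Icc_eq_Icc)
      then show "y = y'" by linarith
    qed
    have IK: "\<exists>u v. I p = cbox u v" "fst p \<in> I p" for p
      by (auto simp: I_def split: prod.splits)
    have IKab: "I p \<subseteq> {a..b}" "I p \<subseteq> \<gamma> (fst p)" if "p \<in> D" for p
    proof -
      obtain x y where p: "p = (x, y)" by (cases p)
      have "x \<in> {a<..<b}" "y \<in> {a..b}" "I (x, y) \<subseteq> \<gamma> x"
        using that D C(2) p Eab[of x] unfolding K_def by auto
      then show "I p \<subseteq> {a..b}" "I p \<subseteq> \<gamma> (fst p)" by (auto simp: p I_def)
    qed
    have "(\<lambda>p. (fst p, I p)) ` D tagged_partial_division_of cbox a b"
      unfolding tagged_partial_division_of_def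
    proof (intro conjI allI impI)
      show "finite ((\<lambda>p. (fst p, I p)) ` D)" using D by simp
    next
      fix x L assume "(x, L) \<in> (\<lambda>p. (fst p, I p)) ` D"
      then obtain p where p: "p \<in> D" "x = fst p" "L = I p" by auto
      show "x \<in> L" "L \<subseteq> cbox a b" "\<exists>a b. L = cbox a b"
        using IK[of p] IKab[of p] p by (simp_all add: cbox_interval)
    next
      fix x1 K1 x2 K2
      assume "(x1, K1) \<in> (\<lambda>p. (fst p, I p)) ` D \<and> (x2, K2) \<in> (\<lambda>p. (fst p, I p)) ` D \<and> (x1, K1) \<noteq> (x2, K2)"
      then obtain p q where "p \<in> D" "q \<in> D" "K1 = I p" "K2 = I q" "p \<noteq> q" by auto
      then have "K1 \<inter> K2 = {}" using disj D(1) by (auto simp: pairwise_def cb disjnt_def)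
      then show "interior K1 \<inter> interior K2 = {}" using interior_subset by blast
    qed
    moreover have "\<gamma> fine ((\<lambda>p. (fst p, I p)) ` D)"
      using IKab by (auto simp: fine_def)
    ultimately have "sum (\<lambda>(x,k). norm(measure lborel k *\<^sub>R f x - integral k f)) ((\<lambda>p. (fst p, I p)) ` D) < e * \<epsilon>"
      by (rule H)
    then have S: "(\<Sum>p\<in>D. norm(measure lborel (I p) *\<^sub>R f (fst p) - integral (I p) f)) < e * \<epsilon>"
      by (simp add: sum.reindex[OF injD])
    have "\<epsilon> * measure lborel (I p) \<le> norm(measure lborel (I p) *\<^sub>R f (fst p) - integral (I p) f)" if "p \<in> D" for p
    proof -
      obtain x y where p: "p = (x, y)" by (cases p)
      have xy: "x \<in> {a<..<b}" "y \<in> {a..b}" "y \<noteq> x"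
         "\<epsilon> * \<bar>y - x\<bar> < norm (integral {a..y} f - integral {a..x} f - (y - x) *\<^sub>R f x)"
        using that D C(2) p Eab[of x] unfolding K_def by auto
      have comb: "integral {a..u} f + integral {u..v} f = integral {a..v} f" if "a \<le> u" "u \<le> v" "v \<le> b" for u v
        using that by (intro Henstock_Kurzweil_Integration.integral_combine)
            (auto intro: integrable_on_subinterval[OF f])
      show ?thesis
      proof (cases "x < y")
        case True
        then have "integral {a..y} f - integral {a..x} f = integral (I p) f"
          using comb[of x y] xy by (simp add: p I_def algebra_simps)
        then show ?thesis using xy(4) True
          by (simp add: p I_def norm_minus_commute)
      next
        case False
        then have "integral {a..y} f - integral {a..x} f = - integral (I p) f"
          using comb[of y x] xy by (simp add: p I_def algebra_simps)
        then have "integral {a..y} f - integral {a..x} f - (y - x) *\<^sub>R f x = measure lborel (I p) *\<^sub>R f x - integral (I p) f"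
          using False by (simp add: p I_def algebra_simps)
        then show ?thesis using xy(4) False
          by (simp add: p I_def)
      qed
    qed
    then have "\<epsilon> * (\<Sum>p\<in>D. measure lborel (I p)) \<le> (\<Sum>p\<in>D. norm(measure lborel (I p) *\<^sub>R f (fst p) - integral (I p) f))"
      unfolding sum_distrib_left by (rule sum_mono)
    with S have "\<epsilon> * (\<Sum>p\<in>D. measure lborel (I p)) \<le> \<epsilon> * e" by (simp add: mult.commute)
    then have "(\<Sum>p\<in>D. measure lborel (I p)) \<le> e" using \<epsilon> by simp
    moreover have "measure lebesgue (\<Union>p\<in>D. I p) \<le> (\<Sum>p\<in>D. measure lborel (I p))"
      using measure_UNION_le[OF D(2), of I lebesgue]
      by (auto simp: I_def split: prod.splits)
    ultimately show ?thesis by linarith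
  qed
  let ?N = "E - (\<Union>i\<in>C. I i)" and ?U = "\<Union>i\<in>C. I i"
  have Im: "I p \<in> lmeasurable" for p by (auto simp: I_def split: prod.splits)
  have U: "?U \<in> lmeasurable" "measure lebesgue ?U \<le> e"
    by (rule fmeasurable_UN_bound[OF C(1) Im bound] measure_UN_bound[OF C(1) Im bound]; assumption)+
  have N: "negligible ?N" using neg by (simp add: cb)
  then have NU: "measure lebesgue (?U \<union> ?N) = measure lebesgue ?U"
    using U by (intro measure_Un_null_set) (auto simp: negligible_iff_null_sets)
  show "\<exists>T. ?E \<subseteq> T \<and> T \<in> lmeasurable \<and> measure lebesgue T \<le> e"
  unfolding E_def[symmetric]
  proof (intro exI conjI)
    show "E \<subseteq> ?U \<union> ?N" by blast
    show "?U \<union> ?N \<in> lmeasurable"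
      using U(1) N by (intro fmeasurable.Un) (auto simp: negligible_imp_measurable)
    show "measure lebesgue (?U \<union> ?N) \<le> e" using NU U(2) by simp
  qed
qed

text \<open>
The differentiation theorem in one dimension, for Henstock-Kurzweil integrable functions: where the
derivative fails, some error level \<open>1 / (n+1)\<close> is exceeded at every scale.
\<close>
theorem indefinite_integral_has_vector_derivative_ae:
  fixes f :: "real \<Rightarrow> 'a::euclidean_space"
  assumes f: "f integrable_on {a..b}"
  shows "negligible {x\<in>{a<..<b}. \<not> ((\<lambda>t. integral {a..t} f) has_vector_derivative f x) (at x)}"
proof -
  define E where "E = (\<lambda>\<epsilon>::real. {x\<in>{a<..<b}. \<forall>d>0. \<exists>y\<in>{a..b}. y \<noteq> x \<and> \<bar>y - x\<bar> < d \<and>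
           \<epsilon> * \<bar>y - x\<bar> < norm (integral {a..y} f - integral {a..x} f - (y - x) *\<^sub>R f x)})"
  have "negligible (\<Union>n. E (inverse (real (Suc n))))"
    unfolding E_def by (intro negligible_Union_nat integral_defect_exceptional_set_negligible[OF f]) simp
  then show ?thesis
  proof (rule negligible_subset, intro subsetI)
    fix x assume x: "x \<in> {x\<in>{a<..<b}. \<not> ((\<lambda>t. integral {a..t} f) has_vector_derivative f x) (at x)}"
    show "x \<in> (\<Union>n. E (inverse (real (Suc n))))"
    proof (rule ccontr)
      assume nx: "x \<notin> (\<Union>n. E (inverse (real (Suc n))))"
      have "\<exists>d>0. \<forall>y. \<bar>y - x\<bar> < d \<longrightarrow>
           norm (integral {a..y} f - integral {a..x} f - (y - x) *\<^sub>R f x) \<le> e * \<bar>y - x\<bar>" if e: "e > 0" for e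
      proof -
        obtain n where n: "inverse (real (Suc n)) < e" using reals_Archimedean[OF e] by blast
        have "x \<notin> E (inverse (real (Suc n)))" using nx by blast
        with x have "\<exists>d>0. \<forall>y\<in>{a..b}. y \<noteq> x \<longrightarrow> \<bar>y - x\<bar> < d \<longrightarrow>
           norm (integral {a..y} f - integral {a..x} f - (y - x) *\<^sub>R f x) \<le> inverse (real (Suc n)) * \<bar>y - x\<bar>"
          unfolding E_def mem_Collect_eq using not_le by blast
        then obtain d where d: "d > 0" "\<And>y. y \<in> {a..b} \<Longrightarrow> y \<noteq> x \<Longrightarrow> \<bar>y - x\<bar> < d \<Longrightarrow>
           norm (integral {a..y} f - integral {a..x} f - (y - x) *\<^sub>R f x) \<le> inverse (real (Suc n)) * \<bar>y - x\<bar>"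
          by blast
        show ?thesis
        proof (intro exI[of _ "min d (min (x - a) (b - x))"] conjI allI impI)
          show "min d (min (x - a) (b - x)) > 0" using d x by auto
          fix y assume y: "\<bar>y - x\<bar> < min d (min (x - a) (b - x))"
          show "norm (integral {a..y} f - integral {a..x} f - (y - x) *\<^sub>R f x) \<le> e * \<bar>y - x\<bar>"
          proof (cases "y = x")
            case False
            have "y \<in> {a..b}" using y unfolding atLeastAtMost_iff by linarith
            with y False d(2)[of y] have "norm (integral {a..y} f - integral {a..x} f - (y - x) *\<^sub>R f x)
               \<le> inverse (real (Suc n)) * \<bar>y - x\<bar>" by auto
            also have "\<dots> \<le> e * \<bar>y - x\<bar>" using n by (intro mult_right_mono) auto
            finally show ?thesis .
          qed auto
        qed
      qed
      then have "((\<lambda>t. integral {a..t} f) has_vector_derivative f x) (at x)"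
        unfolding has_vector_derivative_def has_derivative_at_alt
        by (auto intro: bounded_linear_intros)
      with x show False by simp
    qed
  qed
qed

section \<open>Repeated differentiation and repeated integration\<close>

text \<open>
An integrable derivative forces a limit at the left endpoint, and the function is then the
integral of its derivative plus that limit. It is in particular bounded, so that it is again
integrable; this is what makes the lemma usable repeatedly, for lower and lower derivatives.
\<close>
lemma antiderivative_with_integrable_derivative:
  fixes \<phi> \<psi> :: "real \<Rightarrow> complex"
  assumes cd: "c < d"
    and der: "\<And>x. x \<in> {c<..<d} \<Longrightarrow> (\<phi> has_vector_derivative \<psi> x) (at x)"
    and \<psi>: "\<psi> absolutely_integrable_on {c<..<d}"
  obtains L where "(\<phi> \<longlongrightarrow> L) (at_right c)"
    "\<And>x. x \<in> {c<..<d} \<Longrightarrow> \<phi> x = L + (LINT t:{c<..<x}|lebesgue. \<psi> t)"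
    "\<phi> absolutely_integrable_on {c<..<d}"
proof -
  define I where "I = (\<lambda>x. integral {c..x} \<psi>)"
  have int: "\<psi> integrable_on {c..d}"
    using set_lebesgue_integral_eq_integral(1)[OF \<psi>] by (simp add: integrable_on_Icc_iff_Ioo)
  have I: "continuous_on {c..d} I"
    unfolding I_def by (rule indefinite_integral_continuous_1[OF int])
  have const: "\<phi> v - I v = \<phi> u - I u" if uv: "c < u" "u \<le> v" "v < d" for u v
  proof -
    have "(\<psi> has_integral (\<phi> v - \<phi> u)) {u..v}"
      using uv by (intro fundamental_theorem_of_calculus)
        (auto intro!: has_vector_derivative_at_within der)
    then have "\<phi> v = \<phi> u + integral {u..v} \<psi>" by (simp add: integral_unique)
    moreover have "I u + integral {u..v} \<psi> = I v"
      unfolding I_def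
      using uv by (intro Henstock_Kurzweil_Integration.integral_combine)
         (auto intro: integrable_on_subinterval[OF int])
    ultimately show ?thesis by (simp flip: \<open>I u + _ = I v\<close>)
  qed
  define m where "m = (c + d) / 2"
  have m: "c < m" "m < d" using cd by (auto simp: m_def)
  define L where "L = \<phi> m - I m"
  have eq: "\<phi> x = L + I x" if "x \<in> {c<..<d}" for x
    using const[of x m] const[of m x] that m by (cases "x \<le> m") (auto simp: L_def algebra_simps)
  have "(I \<longlongrightarrow> I c) (at_right c)"
    using I cd by (simp add: continuous_on_Icc_at_rightD)
  then have "((\<lambda>x. L + I x) \<longlongrightarrow> L + 0) (at_right c)"
    by (intro tendsto_add) (auto simp: I_def)
  moreover have "\<forall>\<^sub>F x in at_right c. L + I x = \<phi> x"
    using eventually_at_right_real[OF cd] by eventually_elim (simp add: eq)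
  ultimately have 1: "(\<phi> \<longlongrightarrow> L) (at_right c)"
    by (simp add: filterlim_cong[of "nhds L" "nhds L" "at_right c" "at_right c" "\<lambda>x. L + I x" \<phi>])
  have 2: "\<phi> x = L + (LINT t:{c<..<x}|lebesgue. \<psi> t)" if x: "x \<in> {c<..<d}" for x
  proof -
    have "\<psi> absolutely_integrable_on {c<..<x}"
      by (rule set_integrable_subset[OF \<psi>]) (use x in auto)
    then have "(LINT t:{c<..<x}|lebesgue. \<psi> t) = I x"
      by (simp add: set_lebesgue_integral_eq_integral(2) I_def integral_open_interval_real)
    then show ?thesis using eq[OF x] by simp
  qed
  have "(\<lambda>x. L + I x) absolutely_integrable_on {c..d}"
    by (intro absolutely_integrable_continuous_real continuous_intros I)
  then have "(\<lambda>x. L + I x) absolutely_integrable_on {c<..<d}"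
    by (simp add: absolutely_integrable_on_Icc_iff_Ioo)
  then have 3: "\<phi> absolutely_integrable_on {c<..<d}"
    by (rule set_integrable_cong[THEN iffD1, rotated -1]) (auto simp: eq)
  show ?thesis by (rule that[OF 1 2 3])
qed

lemma nth_deriv_0 [simp]: "nth_deriv 0 f = f"
  by (simp add: nth_deriv_def)

lemma nth_deriv_Suc: "nth_deriv (Suc k) f = (\<lambda>x. vector_derivative (nth_deriv k f) (at x))"
  by (simp add: nth_deriv_def)

lemma iterated_integral_Suc:
  "iterated_integral c (Suc n) f x = (LINT t:{c<..<x}|lebesgue. iterated_integral c n f t)"
  by (simp add: iterated_integral_def)

lemma iterated_integral_0 [simp]: "iterated_integral c 0 f = f"
  by (simp add: iterated_integral_def)

lemma nth_differentiable_at_le: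
  "nth_differentiable_at n f x \<Longrightarrow> k \<le> n \<Longrightarrow> nth_differentiable_at k f x"
proof (induction n)
  case (Suc n)
  from Suc.prems(1) have "nth_differentiable_at n f x"
    by (auto dest: eventually_nhds_x_imp_x)
  with Suc show ?case by (cases "k = Suc n") auto
qed simp

lemma nth_deriv_has_vector_derivative:
  assumes "nth_differentiable_at n f x" "k < n"
  shows "(nth_deriv k f has_vector_derivative nth_deriv (Suc k) f x) (at x)"
proof -
  have "nth_differentiable_at (Suc k) f x" using assms by (intro nth_differentiable_at_le[OF assms(1)]) auto
  then have "nth_deriv k f differentiable (at x)" by simp
  then show ?thesis by (simp add: nth_deriv_Suc vector_derivative_works)
qed

text \<open>
A chain \<open>P\<close> of successive derivatives of \<open>G\<close> on an open set identifies the iterated derivative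
operator there, whose definition only knows pointwise derivatives.
\<close>
lemma nth_deriv_chain:
  assumes S: "open S" and G: "\<And>x. x \<in> S \<Longrightarrow> G x = P 0 x"
    and der: "\<And>k x. k < m \<Longrightarrow> x \<in> S \<Longrightarrow> (P k has_vector_derivative P (Suc k) x) (at x)"
    and k: "k \<le> m" and x: "x \<in> S"
  shows "nth_differentiable_at k G x \<and> nth_deriv k G x = P k x"
  using k x
proof (induction k arbitrary: x)
  case (Suc k)
  have "(P k has_vector_derivative P (Suc k) x) (at x)" using Suc by (intro der) auto
  then have D: "(nth_deriv k G has_vector_derivative P (Suc k) x) (at x)"
    by (rule has_vector_derivative_transform_within_open[OF _ S \<open>x \<in> S\<close>]) (use Suc in auto)
  have "\<forall>\<^sub>F t in nhds x. nth_differentiable_at k G t"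
    using eventually_nhds_in_open[OF S \<open>x \<in> S\<close>] by eventually_elim (use Suc in auto)
  then show ?case
    using D by (auto simp: nth_deriv_Suc differentiableI_vector vector_derivative_at)
qed (use G in auto)

lemma has_vector_derivative_taylor_sum:
  fixes a :: "nat \<Rightarrow> complex"
  shows "((\<lambda>x. \<Sum>k<Suc j. of_real ((x - c) ^ k) * a k / fact k) has_vector_derivative
     (\<Sum>k<j. of_real ((x - c) ^ k) * a (Suc k) / fact k)) (at x)"
proof -
  have "((\<lambda>x. complex_of_real ((x - c) ^ Suc k)) has_vector_derivative of_nat (Suc k) * of_real ((x - c) ^ k)) (at x)" for k
  proof -
    have "((\<lambda>x. (x - c) ^ Suc k) has_real_derivative real (Suc k) * (x - c) ^ k) (at x)"
      by (rule derivative_eq_intros refl | simp)+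
    then show ?thesis by (auto dest!: has_vector_derivative_of_real simp del: power_Suc of_nat_Suc)
  qed
  then have "((\<lambda>x. of_real ((x - c) ^ Suc k) * (a (Suc k) / fact (Suc k))) has_vector_derivative
     (of_nat (Suc k) * of_real ((x - c) ^ k)) * (a (Suc k) / fact (Suc k))) (at x)" for k
    by (rule has_vector_derivative_mult_left)
  then have "((\<lambda>x. of_real ((x - c) ^ Suc k) * a (Suc k) / fact (Suc k)) has_vector_derivative
     of_real ((x - c) ^ k) * a (Suc k) / fact k) (at x)" for k
    by (simp del: of_real_power power_Suc of_nat_Suc add: field_simps)
  then have "((\<lambda>x. a 0 + (\<Sum>k<j. of_real ((x - c) ^ Suc k) * a (Suc k) / fact (Suc k))) has_vector_derivative
     0 + (\<Sum>k<j. of_real ((x - c) ^ k) * a (Suc k) / fact k)) (at x)"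
    by (intro has_vector_derivative_add has_vector_derivative_sum has_vector_derivative_const)
  then show ?thesis by (subst sum.lessThan_Suc_shift) simp
qed

text \<open>
Both parts descend from the n-th derivative. Each lower derivative is integrable and has a limit at
\<open>c\<close> by the lemma on integrable derivatives. For Taylor's formula, let \<open>R j\<close> be the derivative of
order \<open>n - j\<close> minus its Taylor polynomial of degree below \<open>j\<close> at \<open>c\<close>. Then \<open>R (j+1)\<close> is an
antiderivative of \<open>R j\<close> with limit \<open>0\<close> at \<open>c\<close>, so it is the integral of \<open>R j\<close> from \<open>c\<close>.
\<close>
theorem iterated_integral_nth_deriv:
  fixes f :: "real \<Rightarrow> complex"
  assumes cd: "c < d" and f: "\<And>x. x \<in> {c<..<d} \<Longrightarrow> nth_differentiable_at n f x"
    and int: "nth_deriv n f absolutely_integrable_on {c<..<d}"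
  shows "\<And>k. k < n \<Longrightarrow> \<exists>L. (nth_deriv k f \<longlongrightarrow> L) (at_right c)"
    and "\<And>x. x \<in> {c<..<d} \<Longrightarrow> iterated_integral c n (nth_deriv n f) x
        = f x - (\<Sum>k<n. of_real ((x - c) ^ k) * Lim (at_right c) (nth_deriv k f) / fact k)"
proof -
  define \<phi> where "\<phi> = (\<lambda>k. nth_deriv k f)"
  define L where "L = (\<lambda>k. Lim (at_right c) (\<phi> k))"
  have der: "(\<phi> k has_vector_derivative \<phi> (Suc k) x) (at x)" if "k < n" "x \<in> {c<..<d}" for k x
    unfolding \<phi>_def by (rule nth_deriv_has_vector_derivative[OF f]) (use that in auto)
  have ai: "\<phi> (n - i) absolutely_integrable_on {c<..<d}" if "i \<le> n" for i
    using that
  proof (induction i)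
    case 0
    then show ?case using int by (simp add: \<phi>_def)
  next
    case (Suc i)
    then have e: "Suc (n - Suc i) = n - i" by simp
    have "\<phi> (n - i) absolutely_integrable_on {c<..<d}" using Suc by simp
    moreover have "(\<phi> (n - Suc i) has_vector_derivative \<phi> (n - i) x) (at x)" if "x \<in> {c<..<d}" for x
      using der[of "n - Suc i" x] Suc that e by simp
    ultimately show ?case using antiderivative_with_integrable_derivative[OF cd] by metis
  qed
  have lim: "(\<phi> k \<longlongrightarrow> L k) (at_right c)" if kn: "k < n" for k
  proof -
    have "\<phi> (Suc k) absolutely_integrable_on {c<..<d}" using ai[of "n - Suc k"] kn by simp
    then obtain l where "(\<phi> k \<longlongrightarrow> l) (at_right c)"
      using antiderivative_with_integrable_derivative[OF cd der[OF kn]] by blast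
    then show ?thesis by (simp add: L_def tendsto_Lim)
  qed
  then show "\<exists>L. (nth_deriv k f \<longlongrightarrow> L) (at_right c)" if "k < n" for k
    using that by (auto simp: \<phi>_def)
  define R where "R = (\<lambda>j x. \<phi> (n - j) x - (\<Sum>k<j. of_real ((x - c) ^ k) * L (n - j + k) / fact k))"
  have R: "R j absolutely_integrable_on {c<..<d} \<and> (\<forall>x\<in>{c<..<d}. iterated_integral c j (\<phi> n) x = R j x)" if "j \<le> n" for j
    using that
  proof (induction j)
    case 0
    then show ?case using ai[of 0] by (simp add: R_def)
  next
    case (Suc j)
    then have j: "j < n" "Suc (n - Suc j) = n - j" by auto
    have IH: "R j absolutely_integrable_on {c<..<d}" "\<And>x. x \<in> {c<..<d} \<Longrightarrow> iterated_integral c j (\<phi> n) x = R j x"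
      using Suc by auto
    have dR: "(R (Suc j) has_vector_derivative R j x) (at x)" if x: "x \<in> {c<..<d}" for x
    proof -
      have d\<phi>: "(\<phi> (n - Suc j) has_vector_derivative \<phi> (n - j) x) (at x)"
        using der[of "n - Suc j" x] j x by simp
      have e: "n - Suc j + Suc k = n - j + k" for k using j(1) by simp
      from has_vector_derivative_diff[OF d\<phi> has_vector_derivative_taylor_sum[where j = j and c = c and a = "\<lambda>k. L (n - Suc j + k)" and x = x]]
      show ?thesis unfolding R_def e .
    qed
    have lR: "(R (Suc j) \<longlongrightarrow> 0) (at_right c)"
    proof -
      have "((\<lambda>x. \<Sum>k<Suc j. of_real ((x - c) ^ k) * L (n - Suc j + k) / fact k) \<longlongrightarrow>
         (\<Sum>k<Suc j. of_real ((c - c) ^ k) * L (n - Suc j + k) / fact k)) (at_right c)"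
        by (intro tendsto_intros) auto
      also have "(\<Sum>k<Suc j. complex_of_real ((c - c) ^ k) * L (n - Suc j + k) / fact k) = L (n - Suc j)"
        by (subst sum.lessThan_Suc_shift) simp
      finally have "((\<lambda>x. \<phi> (n - Suc j) x - (\<Sum>k<Suc j. of_real ((x - c) ^ k) * L (n - Suc j + k) / fact k))
           \<longlongrightarrow> L (n - Suc j) - L (n - Suc j)) (at_right c)"
        using lim[of "n - Suc j"] j by (intro tendsto_diff) auto
      then show ?thesis by (simp only: R_def) simp
    qed
    obtain l where l: "(R (Suc j) \<longlongrightarrow> l) (at_right c)"
      "\<And>x. x \<in> {c<..<d} \<Longrightarrow> R (Suc j) x = l + (LINT t:{c<..<x}|lebesgue. R j t)"
      "R (Suc j) absolutely_integrable_on {c<..<d}"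
      using antiderivative_with_integrable_derivative[OF cd dR IH(1)] by metis
    have l0: "l = 0" using tendsto_unique[OF _ l(1) lR] by simp
    have "iterated_integral c (Suc j) (\<phi> n) x = R (Suc j) x" if x: "x \<in> {c<..<d}" for x
    proof -
      have "iterated_integral c (Suc j) (\<phi> n) x = (LINT t:{c<..<x}|lebesgue. R j t)"
        unfolding iterated_integral_Suc using x IH(2) by (intro set_lebesgue_integral_cong) auto
      then show ?thesis using l(2)[OF x] l0 by simp
    qed
    with l(3) show ?case by blast
  qed
  show "iterated_integral c n (nth_deriv n f) x
        = f x - (\<Sum>k<n. of_real ((x - c) ^ k) * Lim (at_right c) (nth_deriv k f) / fact k)" if "x \<in> {c<..<d}" for x
    using R[of n] that by (simp add: R_def \<phi>_def L_def)
qed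

section \<open>Growth of the reciprocal Gamma function in a sector\<close>

text \<open>
Comparison with the telescoping sum of \<open>1 / ((x + i) (x + i + 1))\<close>; the summand \<open>i = 0\<close> gives
the \<open>1\<close>.
\<close>
lemma sum_inverse_square_shift_le:
  fixes x :: real assumes x: "x > 0"
  shows "(\<Sum>i\<le>n. x\<^sup>2 / (x + real i)\<^sup>2) \<le> 1 + x"
proof -
  have "(\<Sum>i\<le>n. x\<^sup>2 / (x + real i)\<^sup>2) \<le> 1 + x - x\<^sup>2 / (x + real n)"
  proof (induction n)
    case 0
    then show ?case using x by (simp add: power2_eq_square)
  next
    case (Suc n)
    have p: "x + real n > 0" "x + real n + 1 > 0" using x by auto
    have "x\<^sup>2 / (x + real (Suc n))\<^sup>2 \<le> x\<^sup>2 / ((x + real n) * (x + real n + 1))"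
    proof (intro divide_left_mono)
      show "(x + real n) * (x + real n + 1) \<le> (x + real (Suc n))\<^sup>2"
        using p by (simp add: power2_eq_square algebra_simps)
      show "0 < (x + real (Suc n))\<^sup>2 * ((x + real n) * (x + real n + 1))"
        using p by (intro mult_pos_pos zero_less_power) auto
    qed simp
    also have "\<dots> = x\<^sup>2 / (x + real n) - x\<^sup>2 / (x + real (Suc n))"
      using p by (simp add: field_simps)
    finally show ?case using Suc by simp
  qed
  also have "\<dots> \<le> 1 + x" using x by simp
  finally show ?thesis .
qed

text \<open>
Each factor \<open>|z + i|\<close> exceeds \<open>Re z + i\<close> by at most the factor
\<open>sqrt (1 + u^2) \<le> exp (u^2 / 2)\<close> with \<open>u = Im z / (Re z + i)\<close>, and the sum of the
\<open>u^2\<close> grows only linearly in \<open>Re z\<close>.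
\<close>
lemma norm_pochhammer_sector_le:
  assumes z: "Re z > 0" and M: "\<bar>Im z\<bar> \<le> M * Re z"
  shows "norm (pochhammer z (Suc n)) \<le> pochhammer (Re z) (Suc n) * exp (M\<^sup>2 * (1 + Re z) / 2)"
proof -
  define x y where "x = Re z" and "y = Im z"
  have x: "x > 0" using z by (simp add: x_def)
  have f: "norm (z + of_nat i) \<le> (x + real i) * exp ((y / (x + real i))\<^sup>2 / 2)" for i
  proof -
    define u where "u = x + real i"
    have u: "u > 0" using x by (simp add: u_def)
    have "norm (z + of_nat i) = sqrt (u\<^sup>2 + y\<^sup>2)"
      by (simp add: cmod_def x_def y_def u_def)
    also have "\<dots> \<le> sqrt ((u * exp ((y / u)\<^sup>2 / 2))\<^sup>2)"
    proof (rule real_sqrt_le_mono)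
      have "u\<^sup>2 + y\<^sup>2 = u\<^sup>2 * (1 + (y / u)\<^sup>2)" using u by (simp add: field_simps)
      also have "\<dots> \<le> u\<^sup>2 * exp ((y / u)\<^sup>2)"
        by (intro mult_left_mono exp_ge_add_one_self) auto
      also have "\<dots> = (u * exp ((y / u)\<^sup>2 / 2))\<^sup>2"
        by (simp add: power_mult_distrib exp_double[symmetric])
      finally show "u\<^sup>2 + y\<^sup>2 \<le> (u * exp ((y / u)\<^sup>2 / 2))\<^sup>2" .
    qed
    also have "\<dots> = u * exp ((y / u)\<^sup>2 / 2)" using u by simp
    finally show ?thesis by (simp add: u_def)
  qed
  have "norm (pochhammer z (Suc n)) = (\<Prod>i\<le>n. norm (z + of_nat i))"
    by (simp add: pochhammer_Suc_prod prod_norm atLeast0AtMost)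
  also have "\<dots> \<le> (\<Prod>i\<le>n. (x + real i) * exp ((y / (x + real i))\<^sup>2 / 2))"
    by (intro prod_mono conjI f) auto
  also have "\<dots> = pochhammer x (Suc n) * exp (\<Sum>i\<le>n. (y / (x + real i))\<^sup>2 / 2)"
    by (simp add: pochhammer_Suc_prod prod.distrib exp_sum atLeast0AtMost)
  also have "\<dots> \<le> pochhammer x (Suc n) * exp (M\<^sup>2 * (1 + x) / 2)"
  proof (intro mult_left_mono)
    have "y\<^sup>2 \<le> M\<^sup>2 * x\<^sup>2" using M x power_mono[of "\<bar>y\<bar>" "M * x" 2]
      by (simp add: x_def y_def power_mult_distrib)
    then have "(y / (x + real i))\<^sup>2 / 2 \<le> M\<^sup>2 / 2 * (x\<^sup>2 / (x + real i)\<^sup>2)" for i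
      using divide_right_mono[of "y\<^sup>2" "M\<^sup>2 * x\<^sup>2" "2 * (x + real i)\<^sup>2"]
      by (simp add: power_divide mult.commute)
    then have "(\<Sum>i\<le>n. (y / (x + real i))\<^sup>2 / 2) \<le> (\<Sum>i\<le>n. M\<^sup>2 / 2 * (x\<^sup>2 / (x + real i)\<^sup>2))"
      by (intro sum_mono)
    also have "\<dots> \<le> M\<^sup>2 / 2 * (1 + x)"
      unfolding sum_distrib_left[symmetric]
      by (intro mult_left_mono sum_inverse_square_shift_le x) auto
    finally show "exp (\<Sum>i\<le>n. (y / (x + real i))\<^sup>2 / 2) \<le> exp (M\<^sup>2 * (1 + x) / 2)" by simp
  qed (use x in \<open>auto intro!: pochhammer_nonneg\<close>)
  finally show ?thesis by (simp add: x_def)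
qed

text \<open>
The reciprocal Gamma function is the limit of \<open>pochhammer z (n + 1) / (n! n^z)\<close>, so the bound for
Pochhammer symbols passes to the limit.
\<close>
text \<open>
Since \<open>T\<close> is arbitrary while \<open>M\<close> is fixed, the base of the power can be made as small as desired:
this is super-exponential decay, in the form in which the series below uses it.
\<close>
lemma norm_rGamma_sector_le_real:
  assumes z: "Re z > 0" and M: "\<bar>Im z\<bar> \<le> M * Re z"
  shows "norm (rGamma z) \<le> rGamma (Re z) * exp (M\<^sup>2 * (1 + Re z) / 2)"
proof (rule LIMSEQ_le)
  show "(\<lambda>n. norm (rGamma_series z n)) \<longlonglongrightarrow> norm (rGamma z)"
    by (intro tendsto_norm rGamma_series_LIMSEQ)
  show "(\<lambda>n. rGamma_series (Re z) n * exp (M\<^sup>2 * (1 + Re z) / 2)) \<longlonglongrightarrow> rGamma (Re z) * exp (M\<^sup>2 * (1 + Re z) / 2)"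
    by (intro tendsto_intros)
  have "norm (rGamma_series z n) \<le> rGamma_series (Re z) n * exp (M\<^sup>2 * (1 + Re z) / 2)" for n
    using norm_pochhammer_sector_le[OF assms, of n]
    by (simp add: rGamma_series_def norm_divide norm_mult divide_right_mono)
  then show "\<exists>N. \<forall>n\<ge>N. norm (rGamma_series z n) \<le> rGamma_series (Re z) n * exp (M\<^sup>2 * (1 + Re z) / 2)"
    by blast
qed

text \<open>
The part of Euler's integral for \<open>\<Gamma>(x + 1)\<close> over \<open>[T, \<infinity>)\<close> is at least \<open>T^x exp (-T)\<close>.
\<close>
lemma rGamma_real_le:
  fixes x T :: real
  assumes x: "x > 0" and T: "T > 0"
  shows "rGamma x \<le> x * exp T * T powr (- x)"
proof -
  have "T powr x * exp (- T) \<le> Gamma (x + 1)"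
  proof (rule has_integral_le)
    show "((\<lambda>t. if t \<in> {T..} then T powr x * exp (- t) else 0) has_integral T powr x * exp (- T)) {0..}"
    proof (subst has_integral_restrict)
      show "((\<lambda>t. T powr x * exp (- t)) has_integral T powr x * exp (- T)) {T..}"
        using has_integral_exp_minus_to_infinity[of 1 T] by (intro has_integral_mult_right) simp
    qed (use T in auto)
    show "((\<lambda>t. t powr (x + 1 - 1) / exp t) has_integral Gamma (x + 1)) {0..}"
      using x by (intro Gamma_integral_real) auto
    show "(if t \<in> {T..} then T powr x * exp (- t) else 0) \<le> t powr (x + 1 - 1) / exp t" if "t \<in> {0..}" for t
      using that T x by (auto simp: exp_minus divide_inverse intro!: powr_mono2)
  qed
  also have "Gamma (x + 1) = x * Gamma x" using x by (intro Gamma_plus1) (auto simp: nonpos_Ints_def)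
  finally have "T powr x * exp (- T) \<le> x / rGamma x"
    by (simp add: Gamma_def divide_inverse)
  moreover have "rGamma x > 0" using Gamma_real_pos[OF x] by (simp add: Gamma_def)
  ultimately show ?thesis using x T by (simp add: field_simps exp_minus powr_minus)
qed

lemma norm_rGamma_sector_le:
  assumes z: "Re z > 0" and M: "\<bar>Im z\<bar> \<le> M * Re z" and T: "T > 0"
  shows "norm (rGamma z) \<le> exp (T + M\<^sup>2 / 2) * (exp (1 + M\<^sup>2 / 2) / T) powr Re z"
proof -
  have "norm (rGamma z) \<le> rGamma (Re z) * exp (M\<^sup>2 * (1 + Re z) / 2)"
    by (rule norm_rGamma_sector_le_real[OF z M])
  also have "\<dots> \<le> (Re z * exp T * T powr (- Re z)) * exp (M\<^sup>2 * (1 + Re z) / 2)"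
    by (intro mult_right_mono rGamma_real_le z T) auto
  also have "\<dots> \<le> (exp (Re z) * exp T * T powr (- Re z)) * exp (M\<^sup>2 * (1 + Re z) / 2)"
  proof (intro mult_right_mono)
    show "Re z \<le> exp (Re z)" using exp_ge_add_one_self[of "Re z"] by linarith
  qed auto
  also have "\<dots> = exp (T + M\<^sup>2 / 2) * (exp (1 + M\<^sup>2 / 2) / T) powr Re z"
  proof -
    have 1: "(exp (1 + M\<^sup>2 / 2) / T) powr Re z = exp ((1 + M\<^sup>2 / 2) * Re z) * T powr (- Re z)"
      using T by (simp add: powr_divide exp_powr_real powr_minus_divide)
    have 2: "exp (Re z) * exp T * exp (M\<^sup>2 * (1 + Re z) / 2) = exp (T + M\<^sup>2 / 2) * exp ((1 + M\<^sup>2 / 2) * Re z)"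
      unfolding mult_exp_exp by (rule arg_cong[of _ _ exp]) (simp add: algebra_simps add_divide_distrib)
    have "exp (Re z) * exp T * T powr (- Re z) * exp (M\<^sup>2 * (1 + Re z) / 2) =
       (exp (Re z) * exp T * exp (M\<^sup>2 * (1 + Re z) / 2)) * T powr (- Re z)"
      by (simp only: mult_ac)
    also have "\<dots> = exp (T + M\<^sup>2 / 2) * (exp (1 + M\<^sup>2 / 2) / T) powr Re z"
      unfolding 1 2 by (rule mult.assoc)
    finally show ?thesis .
  qed
  finally show ?thesis .
qed

section \<open>Convolution of power kernels\<close>

text \<open>
All functions of interest vanish to the left of some point, so integrating over the whole line
replaces every integral with a variable endpoint.
\<close>
definition convolution :: "(real \<Rightarrow> complex) \<Rightarrow> (real \<Rightarrow> complex) \<Rightarrow> real \<Rightarrow> complex" where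
  "convolution f g x = (LINT s|lborel. f (x - s) * g s)"

text \<open>
The base case of all kernels. Cutting off at zero makes convolution over the line the same as
integration over \<open>(0, t)\<close>.
\<close>
definition cpower :: "complex \<Rightarrow> real \<Rightarrow> complex" where
  "cpower z t = (if t > 0 then of_real t powr (z - 1) else 0)"

definition rpower :: "real \<Rightarrow> real \<Rightarrow> real" where
  "rpower a t = (if t > 0 then t powr (a - 1) else 0)"

text \<open>
The Riemann-Liouville kernel. The normalisation by \<open>1 / \<Gamma>\<close> turns the Beta integral into the law
\<open>convolution_rl_kernel\<close>.
\<close>
definition rl_kernel :: "complex \<Rightarrow> real \<Rightarrow> complex" where
  "rl_kernel z t = rGamma z * cpower z t"

lemma cpower_pos: "t > 0 \<Longrightarrow> cpower z t = exp ((z - 1) * of_real (ln t))"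
  by (simp add: cpower_def powr_def Ln_of_real)

lemma cpower_nonpos [simp]: "t \<le> 0 \<Longrightarrow> cpower z t = 0"
  by (simp add: cpower_def)

lemma rl_kernel_nonpos [simp]: "t \<le> 0 \<Longrightarrow> rl_kernel z t = 0"
  by (simp add: rl_kernel_def)

lemma rpower_nonneg [simp]: "rpower a t \<ge> 0"
  by (simp add: rpower_def)

lemma norm_cpower: "norm (cpower z t) = rpower (Re z) t"
  by (cases "t > 0") (simp_all add: cpower_pos rpower_def powr_def norm_exp_eq_Re cpower_def)

lemma cpower_scale: "t > 0 \<Longrightarrow> cpower z (t * u) = of_real t powr (z - 1) * cpower z u"
proof -
  assume t: "t > 0"
  show ?thesis
  proof (cases "u > 0")
    case True
    then show ?thesis using t
      by (simp add: cpower_pos ln_mult exp_add[symmetric] powr_def Ln_of_real algebra_simps)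
  next
    case False
    then show ?thesis using t by (simp add: cpower_def zero_less_mult_iff)
  qed
qed

lemma rpower_scale: "t > 0 \<Longrightarrow> rpower a (t * u) = t powr (a - 1) * rpower a u"
  by (auto simp: rpower_def powr_mult zero_less_mult_iff)

lemma measurable_cpower [measurable]: "cpower z \<in> borel_measurable borel"
proof -
  have "cpower z = (\<lambda>t. if t > 0 then exp ((z - 1) * of_real (ln t)) else 0)"
    using cpower_pos by (auto simp: fun_eq_iff)
  then show ?thesis by simp
qed

lemma measurable_rpower [measurable]: "rpower a \<in> borel_measurable borel"
  unfolding rpower_def[abs_def] by measurable

lemma measurable_rl_kernel [measurable]: "rl_kernel z \<in> borel_measurable borel"
  unfolding rl_kernel_def[abs_def] by measurable

lemma measurable_convolution [measurable]:
  assumes [measurable]: "f \<in> borel_measurable borel" "g \<in> borel_measurable borel"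
  shows "convolution f g \<in> borel_measurable borel"
  unfolding convolution_def[abs_def] by measurable

lemma convolution_vanish:
  assumes "\<And>t. t \<le> 0 \<Longrightarrow> K t = 0" "\<forall>s\<le>c. g s = 0" "x \<le> c"
  shows "convolution K g x = 0"
proof -
  have "(\<lambda>s. K (x - s) * g s) = (\<lambda>_. 0)"
  proof
    fix s show "K (x - s) * g s = 0" using assms by (cases "s \<le> c") auto
  qed
  then show ?thesis by (simp add: convolution_def)
qed

text \<open>
Rescaling the variable by \<open>t\<close> reduces this to the Beta integral over \<open>[0, 1]\<close>.
\<close>
lemma nn_integral_rpower_convolution:
  assumes a: "a > 0" and b: "b > 0" and t: "t > 0"
  shows "(\<integral>\<^sup>+s. ennreal (rpower a (t - s) * rpower b s) \<partial>lborel) = ennreal (t powr (a + b - 1) * Beta a b)"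
proof -
  have 1: "(\<integral>\<^sup>+u. ennreal (rpower a (1 - u) * rpower b u) \<partial>lborel) = ennreal (Beta a b)"
  proof -
    have "(\<integral>\<^sup>+u. ennreal (indicator {0..1} u * (u powr (b - 1) * (1 - u) powr (a - 1))) \<partial>lborel) = ennreal (Beta b a)"
      by (rule nn_integral_has_integral_lebesgue[OF _ has_integral_Beta_real[OF b a]]) auto
    also have "(\<lambda>u. indicator {0..1} u * (u powr (b - 1) * (1 - u) powr (a - 1))) = (\<lambda>u. rpower a (1 - u) * rpower b u)"
      by (auto simp: fun_eq_iff rpower_def indicator_def)
    finally show ?thesis by (simp add: Beta_commute)
  qed
  have "(\<integral>\<^sup>+s. ennreal (rpower a (t - s) * rpower b s) \<partial>lborel)
      = ennreal t * (\<integral>\<^sup>+u. ennreal (rpower a (t - (0 + t * u)) * rpower b (0 + t * u)) \<partial>lborel)"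
    using t by (subst nn_integral_real_affine[where c = t and t = 0]) auto
  also have "(\<lambda>u. rpower a (t - (0 + t * u)) * rpower b (0 + t * u)) =
      (\<lambda>u. t powr (a + b - 2) * (rpower a (1 - u) * rpower b u))"
  proof
    fix u
    have "t - (0 + t * u) = t * (1 - u)" by (simp add: algebra_simps)
    then have "rpower a (t - (0 + t * u)) * rpower b (0 + t * u) = t powr (a - 1) * rpower a (1 - u) * (t powr (b - 1) * rpower b u)"
      using t by (simp only: rpower_scale add_0)
    also have "\<dots> = t powr (a - 1) * t powr (b - 1) * (rpower a (1 - u) * rpower b u)" by simp
    also have "t powr (a - 1) * t powr (b - 1) = t powr (a + b - 2)" by (simp flip: powr_add)
    finally show "rpower a (t - (0 + t * u)) * rpower b (0 + t * u) = t powr (a + b - 2) * (rpower a (1 - u) * rpower b u)" .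
  qed
  also have "(\<integral>\<^sup>+u. ennreal (t powr (a + b - 2) * (rpower a (1 - u) * rpower b u)) \<partial>lborel) = ennreal (t powr (a + b - 2)) * ennreal (Beta a b)"
    by (subst 1[symmetric], subst nn_integral_cmult[symmetric]) (simp_all add: ennreal_mult'')
  also have "ennreal t * (ennreal (t powr (a + b - 2)) * ennreal (Beta a b)) = ennreal (t powr (a + b - 1) * Beta a b)"
  proof -
    have "t * t powr (a + b - 2) = t powr (a + b - 1)"
      using t powr_add[of t 1 "a + b - 2"] by simp
    then show ?thesis using t a b
      by (simp add: ennreal_mult'[symmetric] mult.assoc[symmetric])
  qed
  finally show ?thesis .
qed

lemma nn_integral_rpower_convolution_nonpos:
  assumes "t \<le> 0"
  shows "(\<integral>\<^sup>+s. ennreal (rpower a (t - s) * rpower b s) \<partial>lborel) = 0"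
proof -
  have "(\<lambda>s. ennreal (rpower a (t - s) * rpower b s)) = (\<lambda>_. 0)"
    using assms by (auto simp: rpower_def fun_eq_iff)
  then show ?thesis by simp
qed

lemma integrable_rpower_convolution:
  assumes a: "a > 0" and b: "b > 0"
  shows "integrable lborel (\<lambda>s. rpower a (t - s) * rpower b s)"
proof (rule integrableI_nonneg)
  show "(\<integral>\<^sup>+s. ennreal (rpower a (t - s) * rpower b s) \<partial>lborel) < \<infinity>"
    using nn_integral_rpower_convolution[OF a b, of t] nn_integral_rpower_convolution_nonpos[of t a b]
    by (cases "t > 0") auto
qed auto

lemma integral_convolution:
  assumes f: "integrable lborel f" and g: "integrable lborel g"
  shows "(LINT x|lborel. convolution f g x) = (LINT x|lborel. f x) * (LINT x|lborel. g x)"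
proof -
  have [measurable]: "f \<in> borel_measurable borel" "g \<in> borel_measurable borel"
    using f g by auto
  have shift: "integrable lborel (\<lambda>x. f (x - s))" "(LINT x|lborel. f (x - s)) = (LINT x|lborel. f x)"
     "(LINT x|lborel. norm (f (x - s))) = (LINT x|lborel. norm (f x))" for s
    using lborel_integrable_real_affine[OF f, of 1 "-s"] lborel_integral_real_affine[of 1 f "-s"]
      lborel_integral_real_affine[of 1 "\<lambda>x. norm (f x)" "-s"]
    by simp_all
  have int: "integrable (lborel \<Otimes>\<^sub>M lborel) (\<lambda>(s, x). f (x - s) * g s)"
  proof (rule lborel_pair.Fubini_integrable)
    show "integrable lborel (\<lambda>s. LINT x|lborel. norm (case (s, x) of (s, x) \<Rightarrow> f (x - s) * g s))"
      using g by (simp add: norm_mult shift)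
    show "AE s in lborel. integrable lborel (\<lambda>x. case (s, x) of (s, x) \<Rightarrow> f (x - s) * g s)"
      using shift(1) by simp
  qed auto
  have "(LINT x|lborel. convolution f g x) = (LINT s|lborel. LINT x|lborel. f (x - s) * g s)"
    unfolding convolution_def by (rule lborel_pair.Fubini_integral[OF int])
  also have "\<dots> = (LINT x|lborel. f x) * (LINT x|lborel. g x)"
    by (simp add: shift)
  finally show ?thesis .
qed

text \<open>
Fubini at one fixed point \<open>x\<close>. The uniform bound on the convolution of \<open>|f|\<close> and \<open>|g|\<close>, on the
range of arguments that \<open>h\<close> can reach, is what makes the triple product integrable.
\<close>
lemma convolution_assoc:
  assumes [measurable]: "f \<in> borel_measurable borel" "g \<in> borel_measurable borel"
    and h: "integrable lborel h" and h0: "\<And>s. s \<le> c \<Longrightarrow> h s = 0"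
    and B: "\<And>t. t < x - c \<Longrightarrow> (\<integral>\<^sup>+u. norm (f (t - u) * g u) \<partial>lborel) \<le> ennreal B"
  shows "convolution f (convolution g h) x = convolution (convolution f g) h x"
proof -
  have [measurable]: "h \<in> borel_measurable borel" using h by auto
  let ?F = "\<lambda>s u. f (x - u) * (g (u - s) * h s)"
  have inner: "(\<integral>\<^sup>+u. norm (?F s u) \<partial>lborel) \<le> ennreal (B * norm (h s))" for s
  proof (cases "s \<le> c")
    case False
    have "(\<integral>\<^sup>+u. norm (?F s u) \<partial>lborel) = (\<integral>\<^sup>+v. norm (?F s (s + 1 * v)) \<partial>lborel)"
      by (subst nn_integral_real_affine[where c = 1 and t = s]) auto
    also have "\<dots> = (\<integral>\<^sup>+v. ennreal (norm (h s)) * norm (f ((x - s) - v) * g v) \<partial>lborel)"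
      by (intro nn_integral_cong) (simp add: norm_mult ennreal_mult'[symmetric] algebra_simps)
    also have "\<dots> = ennreal (norm (h s)) * (\<integral>\<^sup>+v. norm (f ((x - s) - v) * g v) \<partial>lborel)"
      by (rule nn_integral_cmult) auto
    also have "\<dots> \<le> ennreal (norm (h s)) * ennreal B"
      using False by (intro mult_left_mono B) auto
    also have "\<dots> = ennreal (B * norm (h s))" by (simp add: ennreal_mult'' mult.commute)
    finally show ?thesis .
  qed (simp add: h0)
  have int: "integrable (lborel \<Otimes>\<^sub>M lborel) (\<lambda>(s, u). ?F s u)"
  proof (rule integrableI_bounded)
    have "(\<integral>\<^sup>+p. norm (case p of (s, u) \<Rightarrow> ?F s u) \<partial>(lborel \<Otimes>\<^sub>M lborel)) = (\<integral>\<^sup>+s. \<integral>\<^sup>+u. norm (?F s u) \<partial>lborel \<partial>lborel)"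
      by (subst lborel.nn_integral_fst[symmetric]) auto
    also have "\<dots> \<le> (\<integral>\<^sup>+s. ennreal (B * norm (h s)) \<partial>lborel)"
      by (intro nn_integral_mono inner)
    also have "\<dots> \<le> (\<integral>\<^sup>+s. ennreal (norm (B * norm (h s))) \<partial>lborel)"
      by (intro nn_integral_mono ennreal_leI) auto
    also have "\<dots> < \<infinity>"
    proof -
      have "integrable lborel (\<lambda>s. B * norm (h s))" using h by auto
      then show ?thesis unfolding integrable_iff_bounded by blast
    qed
    finally show "(\<integral>\<^sup>+p. norm (case p of (s, u) \<Rightarrow> ?F s u) \<partial>(lborel \<Otimes>\<^sub>M lborel)) < \<infinity>" .
  qed auto
  have "convolution f (convolution g h) x = (LINT u|lborel. LINT s|lborel. ?F s u)"
    unfolding convolution_def by simp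
  also have "\<dots> = (LINT s|lborel. LINT u|lborel. ?F s u)"
    by (rule lborel_pair.Fubini_integral[OF int])
  also have "\<dots> = convolution (convolution f g) h x"
    unfolding convolution_def
  proof (rule Bochner_Integration.integral_cong[OF refl])
    fix s
    have "(LINT u|lborel. ?F s u) = (LINT v|lborel. ?F s (s + 1 * v))"
      using lborel_integral_real_affine[of 1 "?F s" s] by simp
    also have "\<dots> = (LINT v|lborel. f (x - s - v) * g v * h s)"
      by (simp add: algebra_simps)
    finally show "(LINT u|lborel. ?F s u) = (LINT v|lborel. f (x - s - v) * g v) * h s" by simp
  qed
  finally show ?thesis .
qed

lemma convolution_cpower_scale:
  assumes t: "t > 0"
  shows "convolution (cpower z) (cpower w) t = cpower (z + w) t * convolution (cpower z) (cpower w) 1"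
proof -
  have "convolution (cpower z) (cpower w) t = t *\<^sub>R (LINT u|lborel. cpower z (t - t * u) * cpower w (t * u))"
    unfolding convolution_def using t by (subst lborel_integral_real_affine[of t _ 0]) simp_all
  also have "(\<lambda>u. cpower z (t - t * u) * cpower w (t * u)) =
     (\<lambda>u. (of_real t powr (z - 1) * of_real t powr (w - 1)) * (cpower z (1 - u) * cpower w u))"
  proof
    fix u
    have "cpower z (t - t * u) = cpower z (t * (1 - u))" by (simp add: algebra_simps)
    then show "cpower z (t - t * u) * cpower w (t * u) =
       (of_real t powr (z - 1) * of_real t powr (w - 1)) * (cpower z (1 - u) * cpower w u)"
      using t by (simp add: cpower_scale)
  qed
  also have "t *\<^sub>R (LINT u|lborel. (of_real t powr (z - 1) * of_real t powr (w - 1)) * (cpower z (1 - u) * cpower w u)) =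
     (of_real t * (of_real t powr (z - 1) * of_real t powr (w - 1))) * convolution (cpower z) (cpower w) 1"
    by (simp add: convolution_def scaleR_conv_of_real)
  also have "of_real t * (of_real t powr (z - 1) * of_real t powr (w - 1)) = cpower (z + w) t"
  proof -
    have "complex_of_real t = exp (of_real (ln t))" using t by (simp add: exp_of_real)
    then show ?thesis using t
      by (simp add: cpower_pos powr_def Ln_of_real mult_exp_exp) (simp add: algebra_simps)
  qed
  finally show ?thesis .
qed

lemma Gamma_integral_lborel:
  assumes z: "Re z > 0"
  shows "integrable lborel (\<lambda>t. cpower z t * of_real (exp (- t)))"
    and "(LINT t|lborel. cpower z t * of_real (exp (- t))) = Gamma z"
proof -
  have eq: "(\<lambda>t. indicator {0<..} t *\<^sub>R (complex_of_real t powr (z - 1) / of_real (exp t))) = (\<lambda>t. cpower z t * of_real (exp (- t)))"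
    by (auto simp: fun_eq_iff cpower_def indicator_def exp_minus divide_inverse)
  have "set_integrable lebesgue {0<..} (\<lambda>t. complex_of_real t powr (z - 1) / of_real (exp t))"
    by (rule absolutely_integrable_Gamma_integral'[OF z])
  then show int: "integrable lborel (\<lambda>t. cpower z t * of_real (exp (- t)))"
    unfolding set_integrable_def eq by (subst (asm) integrable_completion) auto
  have "((\<lambda>t. cpower z t * of_real (exp (- t))) has_integral Gamma z) UNIV"
  proof -
    have "((\<lambda>t. if t \<in> {0<..} then complex_of_real t powr (z - 1) / of_real (exp t) else 0) has_integral Gamma z) UNIV"
      unfolding has_integral_restrict_UNIV by (rule Gamma_integral_complex'[OF z])
    also have "(\<lambda>t. if t \<in> {0<..} then complex_of_real t powr (z - 1) / of_real (exp t) else 0) = (\<lambda>t. cpower z t * of_real (exp (- t)))"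
      by (auto simp: fun_eq_iff cpower_def exp_minus divide_inverse)
    finally show ?thesis .
  qed
  with has_integral_integral_lborel[OF int]
  show "(LINT t|lborel. cpower z t * of_real (exp (- t))) = Gamma z"
    by (rule has_integral_unique)
qed

text \<open>
Euler's Beta integral for complex exponents. By homogeneity the convolution of two powers is
\<open>C t^(z + w - 1)\<close> with an unknown constant \<open>C\<close>. Weighting all functions by \<open>exp (-t)\<close>, which
is compatible with convolution, and integrating over the line gives \<open>\<Gamma>(z) \<Gamma>(w) = C \<Gamma>(z + w)\<close>.
\<close>
theorem convolution_rl_kernel:
  assumes z: "Re z > 0" and w: "Re w > 0"
  shows "convolution (rl_kernel z) (rl_kernel w) = rl_kernel (z + w)"
proof
  fix t :: real
  define e where "e = (\<lambda>z t. cpower z t * of_real (exp (- t)))"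
  define C where "C = convolution (cpower z) (cpower w) 1"
  have zw: "Re (z + w) > 0" using z w by simp
  have "Gamma u \<noteq> 0" if "Re u > 0" for u
    using that by (auto simp: Gamma_eq_zero_iff elim!: nonpos_Ints_cases)
  then have nz: "Gamma z \<noteq> 0" "Gamma w \<noteq> 0" "Gamma (z + w) \<noteq> 0"
    using z w zw by blast+
  have conv: "convolution (cpower z) (cpower w) t = C * cpower (z + w) t" for t
  proof (cases "t > 0")
    case False
    have "(\<lambda>s. cpower z (t - s) * cpower w s) = (\<lambda>_. 0)"
      using False by (auto simp: fun_eq_iff cpower_def)
    then show ?thesis using False by (simp add: convolution_def)
  next
    case True
    show ?thesis unfolding convolution_cpower_scale[OF True] C_def by (rule mult.commute)
  qed
  have ec: "convolution (e z) (e w) t = C * e (z + w) t" for t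
  proof -
    have "e z (t - s) * e w s = of_real (exp (- t)) * (cpower z (t - s) * cpower w s)" for s
    proof -
      have "complex_of_real (exp (- (t - s))) * of_real (exp (- s)) = of_real (exp (- t))"
        by (simp flip: of_real_mult add: mult_exp_exp)
      then show ?thesis by (simp add: e_def)
    qed
    then have "convolution (e z) (e w) t = of_real (exp (- t)) * convolution (cpower z) (cpower w) t"
      by (simp add: convolution_def)
    then show ?thesis by (simp add: conv e_def)
  qed
  have "Gamma z * Gamma w = (LINT t|lborel. convolution (e z) (e w) t)"
    unfolding e_def using Gamma_integral_lborel[OF z] Gamma_integral_lborel[OF w]
    by (subst integral_convolution) auto
  also have "\<dots> = C * Gamma (z + w)"
    using Gamma_integral_lborel[OF zw] by (simp add: ec) (simp add: e_def)
  finally have C: "C = Gamma z * Gamma w * rGamma (z + w)"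
    using nz by (simp add: rGamma_inverse_Gamma field_simps)
  have "convolution (rl_kernel z) (rl_kernel w) t = rGamma z * rGamma w * convolution (cpower z) (cpower w) t"
  proof -
    have "rl_kernel z (t - s) * rl_kernel w s = (rGamma z * rGamma w) * (cpower z (t - s) * cpower w s)" for s
      by (simp add: rl_kernel_def)
    then show ?thesis by (simp add: convolution_def)
  qed
  also have "\<dots> = rl_kernel (z + w) t"
    using nz by (simp add: conv C rl_kernel_def rGamma_inverse_Gamma field_simps)
  finally show "convolution (rl_kernel z) (rl_kernel w) t = rl_kernel (z + w) t" .
qed

section \<open>Summability of the Mittag-Leffler coefficients\<close>

lemma norm_pochhammer_le_fact:
  fixes \<delta> :: complex
  shows "norm (pochhammer \<delta> m) \<le> fact m * (1 + norm \<delta>) ^ m"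
proof (induction m)
  case (Suc m)
  have "norm (\<delta> + of_nat m) \<le> norm \<delta> + real m" by (metis norm_triangle_ineq norm_of_nat)
  also have "\<dots> \<le> real (Suc m) * (1 + norm \<delta>)" by (simp add: algebra_simps)
  finally have "norm (pochhammer \<delta> m) * norm (\<delta> + of_nat m) \<le> (fact m * (1 + norm \<delta>) ^ m) * (real (Suc m) * (1 + norm \<delta>))"
    using Suc by (intro mult_mono) auto
  moreover have "norm (pochhammer \<delta> (Suc m)) = norm (pochhammer \<delta> m) * norm (\<delta> + of_nat m)"
    unfolding pochhammer_Suc norm_mult ..
  moreover have "fact (Suc m) * (1 + norm \<delta>) ^ Suc m = (fact m * (1 + norm \<delta>) ^ m) * (real (Suc m) * (1 + norm \<delta>))"
    unfolding fact_Suc power_Suc by (simp only: mult_ac)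
  ultimately show ?case by linarith
qed simp

lemma fact_add_le: "fact (k + l) \<le> (2 ^ (k + l) * fact k * fact l :: real)"
proof -
  have "fact (k + l) = (of_nat ((k + l) choose k) * fact k * fact l :: real)"
    using binomial_fact[of k "k + l", where 'a = real] by simp
  also have "\<dots> \<le> 2 ^ (k + l) * fact k * fact l"
  proof (intro mult_right_mono)
    have "real ((k + l) choose k) \<le> real (2 ^ (k + l))"
      by (subst of_nat_le_iff) (rule binomial_le_pow2)
    then show "real ((k + l) choose k) \<le> 2 ^ (k + l)" by simp
  qed auto
  finally show ?thesis .
qed

lemma abs_summable_on_product:
  fixes f :: "'a \<Rightarrow> 'c::{real_normed_div_algebra,banach}" and g :: "'b \<Rightarrow> 'c"
  assumes f: "(\<lambda>x. norm (f x)) summable_on A" and g: "(\<lambda>y. norm (g y)) summable_on B"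
  shows "(\<lambda>p. norm (case p of (x, y) \<Rightarrow> f x * g y)) summable_on A \<times> B"
  unfolding Infinite_Sum.abs_summable_on_Sigma_iff
  using assms
  by (auto simp: norm_mult infsum_cmult_right' abs_mult infsum_nonneg intro!: summable_on_cmult_right summable_on_cmult_left)

definition ml_coeff :: "complex \<Rightarrow> complex \<Rightarrow> complex \<Rightarrow> nat \<times> nat \<Rightarrow> complex" where
  "ml_coeff \<omega>1 \<omega>2 \<delta> = (\<lambda>(k, l). pochhammer \<delta> (k + l) / (fact k * fact l) * \<omega>1 ^ k * \<omega>2 ^ l)"

definition ml_exponent :: "complex \<Rightarrow> complex \<Rightarrow> complex \<Rightarrow> nat \<times> nat \<Rightarrow> complex" where
  "ml_exponent \<alpha> \<beta> \<gamma> = (\<lambda>(k, l). \<alpha> * of_nat k + \<beta> * of_nat l + \<gamma>)"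

text \<open>
The coefficients grow at most geometrically in \<open>k + l\<close>, because \<open>pochhammer \<delta> m / m!\<close> does and
\<open>m! / (k! l!)\<close> is a binomial coefficient.
\<close>
lemma norm_ml_coeff_le:
  "norm (ml_coeff \<omega>1 \<omega>2 \<delta> (k, l)) \<le> (2 * (1 + norm \<delta>) * (1 + norm \<omega>1 + norm \<omega>2)) ^ (k + l)"
proof -
  have "norm (pochhammer \<delta> (k + l)) \<le> (2 ^ (k + l) * fact k * fact l) * (1 + norm \<delta>) ^ (k + l)"
    using norm_pochhammer_le_fact[of \<delta> "k + l"] fact_add_le[of k l]
    by (meson mult_right_mono norm_ge_zero order_trans zero_le_power add_nonneg_nonneg zero_le_one)
  then have "norm (pochhammer \<delta> (k + l)) \<le> (2 * (1 + norm \<delta>)) ^ (k + l) * (fact k * fact l)"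
    unfolding power_mult_distrib by (simp only: mult_ac)
  then have "norm (pochhammer \<delta> (k + l) / (fact k * fact l)) \<le> (2 * (1 + norm \<delta>)) ^ (k + l)"
    by (simp add: norm_divide norm_mult divide_le_eq)
  moreover have "norm (\<omega>1 ^ k * \<omega>2 ^ l) \<le> (1 + norm \<omega>1 + norm \<omega>2) ^ k * (1 + norm \<omega>1 + norm \<omega>2) ^ l"
    by (auto simp: norm_mult norm_power intro!: mult_mono power_mono add_nonneg_nonneg)
  ultimately have "norm (pochhammer \<delta> (k + l) / (fact k * fact l)) * norm (\<omega>1 ^ k * \<omega>2 ^ l)
     \<le> (2 * (1 + norm \<delta>)) ^ (k + l) * ((1 + norm \<omega>1 + norm \<omega>2) ^ k * (1 + norm \<omega>1 + norm \<omega>2) ^ l)"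
    by (intro mult_mono) auto
  also have "\<dots> = (2 * (1 + norm \<delta>) * (1 + norm \<omega>1 + norm \<omega>2)) ^ (k + l)"
    by (simp add: power_mult_distrib flip: power_add)
  finally show ?thesis
    by (simp add: ml_coeff_def mult.assoc flip: norm_mult)
qed

text \<open>
The exponents stay in a sector \<open>|Im z| \<le> M Re z\<close>, where \<open>1 / \<Gamma>(z)\<close> decays faster than every
exponential and so beats the geometric growth of the coefficients.
\<close>
theorem ml_coeff_rGamma_abs_summable:
  assumes a: "Re \<alpha> > 0" and b: "Re \<beta> > 0" and g: "Re \<gamma> > 0" and T: "T > 0"
  shows "(\<lambda>p. norm (ml_coeff \<omega>1 \<omega>2 \<delta> p * rGamma (ml_exponent \<alpha> \<beta> \<gamma> p) *
           of_real (T powr Re (ml_exponent \<alpha> \<beta> \<gamma> p)))) summable_on UNIV"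
proof -
  define D where "D = 2 * (1 + norm \<delta>) * (1 + norm \<omega>1 + norm \<omega>2)"
  have D: "D \<ge> 1"
  proof -
    have "1 * 1 \<le> (2 * (1 + norm \<delta>)) * (1 + norm \<omega>1 + norm \<omega>2)"
      by (intro mult_mono) (auto intro!: add_nonneg_nonneg)
    then show ?thesis by (simp add: D_def)
  qed
  \<comment> \<open>The opening of the sector that contains \<open>\<alpha>\<close>, \<open>\<beta>\<close>, \<open>\<gamma>\<close> and hence all sums of them.\<close>
  define M where "M = max (\<bar>Im \<alpha>\<bar> / Re \<alpha>) (max (\<bar>Im \<beta>\<bar> / Re \<beta>) (\<bar>Im \<gamma>\<bar> / Re \<gamma>))"
  have M: "\<bar>Im \<alpha>\<bar> \<le> M * Re \<alpha>" "\<bar>Im \<beta>\<bar> \<le> M * Re \<beta>" "\<bar>Im \<gamma>\<bar> \<le> M * Re \<gamma>"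
    using a b g by (simp_all add: M_def flip: pos_divide_le_eq)
  define m where "m = min (Re \<alpha>) (Re \<beta>)"
  have m: "m > 0" "m \<le> Re \<alpha>" "m \<le> Re \<beta>" using a b by (auto simp: m_def)
  \<comment> \<open>The decay rate to aim for: it makes the series geometric with ratio at most \<open>1 / 2\<close> in each index.\<close>
  define q where "q = (1 / (2 * D)) powr (1 / m)"
  have q: "q > 0" "q \<le> 1" using D m by (auto simp: q_def intro!: powr_le1)
  have qm: "q powr m = 1 / (2 * D)" using D m by (simp add: q_def powr_powr)
  have qa: "D * q powr Re \<alpha> \<le> 1 / 2" "D * q powr Re \<beta> \<le> 1 / 2"
  proof -
    have "q powr Re \<alpha> \<le> q powr m" "q powr Re \<beta> \<le> q powr m"
      using q m by (auto intro!: powr_mono')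
    then show "D * q powr Re \<alpha> \<le> 1 / 2" "D * q powr Re \<beta> \<le> 1 / 2"
      using D qm by (simp_all add: field_simps)
  qed
  \<comment> \<open>The free parameter of the bound for \<open>1 / \<Gamma>\<close>, chosen so that the bound becomes \<open>(q / T)\<close> to the power \<open>Re z\<close>.\<close>
  define R where "R = exp (1 + M\<^sup>2 / 2) * T / q"
  have R: "R > 0" using q T by (simp add: R_def)
  define C where "C = exp (R + M\<^sup>2 / 2) * q powr Re \<gamma>"
  have C: "C \<ge> 0" by (simp add: C_def)
  have bound: "norm (ml_coeff \<omega>1 \<omega>2 \<delta> (k, l) * rGamma (ml_exponent \<alpha> \<beta> \<gamma> (k, l)) *
       of_real (T powr Re (ml_exponent \<alpha> \<beta> \<gamma> (k, l)))) \<le> C * ((1 / 2) ^ k * (1 / 2) ^ l)" for k l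
  proof -
    define z where "z = ml_exponent \<alpha> \<beta> \<gamma> (k, l)"
    have Rez: "Re z = Re \<alpha> * k + Re \<beta> * l + Re \<gamma>" and Imz: "Im z = Im \<alpha> * k + Im \<beta> * l + Im \<gamma>"
      by (simp_all add: z_def ml_exponent_def)
    have z: "Re z > 0" unfolding Rez using a b g by (intro add_nonneg_pos add_nonneg_nonneg) auto
    have "\<bar>Im z\<bar> \<le> \<bar>Im \<alpha>\<bar> * k + \<bar>Im \<beta>\<bar> * l + \<bar>Im \<gamma>\<bar>"
      unfolding Imz by (simp add: abs_triangle_ineq[THEN order_trans] abs_mult add_mono)
    also have "\<dots> \<le> (M * Re \<alpha>) * k + (M * Re \<beta>) * l + M * Re \<gamma>"
      using M by (intro add_mono mult_right_mono) auto
    also have "\<dots> = M * Re z" by (simp add: Rez algebra_simps)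
    finally have "norm (rGamma z) \<le> exp (R + M\<^sup>2 / 2) * (exp (1 + M\<^sup>2 / 2) / R) powr Re z"
      by (intro norm_rGamma_sector_le z R)
    also have "exp (1 + M\<^sup>2 / 2) / R = q / T" using T q by (simp add: R_def)
    also have "(q / T) powr Re z = q powr Re z / T powr Re z" using q T by (simp add: powr_divide)
    finally have "norm (rGamma z) * T powr Re z \<le> exp (R + M\<^sup>2 / 2) * q powr Re z"
      using T by (simp add: field_simps)
    also have "q powr Re z = (q powr Re \<alpha>) ^ k * (q powr Re \<beta>) ^ l * q powr Re \<gamma>"
      using q by (simp add: Rez powr_add powr_powr[symmetric] powr_realpow)
    finally have "norm (ml_coeff \<omega>1 \<omega>2 \<delta> (k, l)) * (norm (rGamma z) * T powr Re z) \<le>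
       D ^ (k + l) * (exp (R + M\<^sup>2 / 2) * ((q powr Re \<alpha>) ^ k * (q powr Re \<beta>) ^ l * q powr Re \<gamma>))"
      using norm_ml_coeff_le[of \<omega>1 \<omega>2 \<delta> k l, folded D_def] D by (intro mult_mono[of _ "D ^ (k + l)"]) auto
    also have "\<dots> = C * ((D * q powr Re \<alpha>) ^ k * (D * q powr Re \<beta>) ^ l)"
      by (simp add: C_def power_mult_distrib power_add)
    also have "\<dots> \<le> C * ((1 / 2) ^ k * (1 / 2) ^ l)"
      using qa D C by (intro mult_left_mono mult_mono power_mono) auto
    finally show ?thesis by (simp add: z_def norm_mult mult.assoc)
  qed
  have geo: "(\<lambda>k. norm ((1 / 2 :: real) ^ k)) summable_on UNIV"
    by (subst summable_on_UNIV_nonneg_real_iff) (auto simp: summable_geometric norm_power)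
  have "(\<lambda>p. norm (case p of (k, l) \<Rightarrow> (1 / 2 :: real) ^ k * (1 / 2) ^ l)) summable_on UNIV \<times> UNIV"
    by (rule abs_summable_on_product[OF geo geo])
  then have "(\<lambda>p. norm (C * (case p of (k, l) \<Rightarrow> (1 / 2 :: real) ^ k * (1 / 2) ^ l))) summable_on UNIV"
    unfolding norm_mult by (intro summable_on_cmult_right) simp
  then show ?thesis
    by (rule Infinite_Sum.abs_summable_on_comparison_test)
       (use bound C in \<open>auto simp: abs_mult split: prod.splits\<close>)
qed

section \<open>Interchanging countable sums and integrals\<close>

text \<open>
Enumerating the index set reduces this to termwise integration of series indexed by natural numbers.
\<close>
lemma has_sum_integral:
  fixes f :: "'i::countable \<Rightarrow> 'a \<Rightarrow> complex"
  assumes inf: "infinite (UNIV :: 'i set)"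
    and int: "\<And>i. integrable M (f i)"
    and sm: "\<And>x. (\<lambda>i. norm (f i x)) summable_on UNIV"
    and sI: "(\<lambda>i. LINT x|M. norm (f i x)) summable_on UNIV"
  shows "((\<lambda>i. LINT x|M. f i x) has_sum (LINT x|M. (\<Sum>\<^sub>\<infinity>i. f i x))) UNIV"
proof -
  obtain b :: "nat \<Rightarrow> 'i" where b: "bij_betw b UNIV UNIV"
    using bij_betw_from_nat_into[OF countableI_type inf] by blast
  have sm': "summable (\<lambda>n. norm (f (b n) x))" for x
    using sm[of x] summable_on_reindex_bij_betw[OF b, of "\<lambda>i. norm (f i x)"]
      summable_on_UNIV_nonneg_real_iff[of "\<lambda>n. norm (f (b n) x)"]
    by simp
  have sI': "summable (\<lambda>n. LINT x|M. norm (f (b n) x))"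
    using sI summable_on_reindex_bij_betw[OF b, of "\<lambda>i. LINT x|M. norm (f i x)"]
      summable_on_UNIV_nonneg_real_iff[of "\<lambda>n. LINT x|M. norm (f (b n) x)"]
    by simp
  have "(\<lambda>n. LINT x|M. f (b n) x) sums (LINT x|M. (\<Sum>n. f (b n) x))"
    by (rule sums_integral[OF int _ sI']) (simp add: sm')
  moreover have "(\<Sum>n. f (b n) x) = (\<Sum>\<^sub>\<infinity>i. f i x)" for x
  proof -
    have "((\<lambda>n. f (b n) x) has_sum (\<Sum>n. f (b n) x)) UNIV"
      by (rule norm_summable_imp_has_sum[OF sm' summable_sums]) (rule summable_norm_cancel[OF sm'])
    then have "((\<lambda>i. f i x) has_sum (\<Sum>n. f (b n) x)) UNIV"
      using has_sum_reindex_bij_betw[OF b, of "\<lambda>i. f i x"] by blast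
    then show ?thesis by (simp add: infsumI)
  qed
  ultimately have "(\<lambda>n. LINT x|M. f (b n) x) sums (LINT x|M. (\<Sum>\<^sub>\<infinity>i. f i x))" by simp
  moreover have "summable (\<lambda>n. norm (LINT x|M. f (b n) x))"
    by (rule summable_comparison_test'[OF sI']) (simp add: integral_norm_bound)
  ultimately have "((\<lambda>n. LINT x|M. f (b n) x) has_sum (LINT x|M. (\<Sum>\<^sub>\<infinity>i. f i x))) UNIV"
    by (intro norm_summable_imp_has_sum)
  then show ?thesis
    using has_sum_reindex_bij_betw[OF b, of "\<lambda>i. LINT x|M. f i x"] by blast
qed

lemma infsum_product_abs_summable:
  fixes f :: "'a \<Rightarrow> complex" and g :: "'b \<Rightarrow> complex"
  assumes f: "(\<lambda>x. norm (f x)) summable_on A" and g: "(\<lambda>y. norm (g y)) summable_on B"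
  shows "(\<Sum>\<^sub>\<infinity>(x, y)\<in>A \<times> B. f x * g y) = (\<Sum>\<^sub>\<infinity>x\<in>A. f x) * (\<Sum>\<^sub>\<infinity>y\<in>B. g y)"
proof -
  have "(\<lambda>(x, y). f x * g y) summable_on A \<times> B"
    by (rule abs_summable_summable[OF abs_summable_on_product[OF f g]])
  from infsum_Sigma'_banach[OF this] show ?thesis
    by (simp add: infsum_cmult_right' infsum_cmult_left')
qed

section \<open>The convolution identity for the coefficients\<close>

lemma sum_binomial_Suc:
  fixes Q :: "nat \<Rightarrow> 'a::comm_ring_1"
  shows "(\<Sum>k\<le>Suc K. of_nat (Suc K choose k) * Q k) = (\<Sum>k\<le>K. of_nat (K choose k) * (Q k + Q (Suc k)))"
proof -
  have "(\<Sum>k\<le>Suc K. of_nat (Suc K choose k) * Q k) =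
      Q 0 + (\<Sum>k\<le>K. of_nat (K choose Suc k) * Q (Suc k)) + (\<Sum>k\<le>K. of_nat (K choose k) * Q (Suc k))"
    by (subst sum.atMost_Suc_shift) (simp add: sum.distrib algebra_simps)
  also have "Q 0 + (\<Sum>k\<le>K. of_nat (K choose Suc k) * Q (Suc k)) = (\<Sum>k\<le>Suc K. of_nat (K choose k) * Q k)"
    by (subst sum.atMost_Suc_shift) simp
  also have "\<dots> = (\<Sum>k\<le>K. of_nat (K choose k) * Q k)" by (simp add: binomial_eq_0)
  finally show ?thesis by (simp add: sum.distrib algebra_simps)
qed

text \<open>
Vandermonde's identity with an arbitrary weight \<open>P\<close> on \<open>k + l\<close>. The weight has to be general
for the induction on \<open>K\<close>, in which Pascal's rule replaces \<open>P m\<close> by \<open>P m + P (m + 1)\<close>.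
\<close>
lemma sum_vandermonde:
  fixes P :: "nat \<Rightarrow> 'a::comm_ring_1"
  shows "(\<Sum>k\<le>K. \<Sum>l\<le>L. of_nat (K choose k) * of_nat (L choose l) * P (k + l)) =
         (\<Sum>m\<le>K + L. of_nat ((K + L) choose m) * P m)"
proof (induction K arbitrary: P)
  case (Suc K)
  have "(\<Sum>k\<le>Suc K. \<Sum>l\<le>L. of_nat (Suc K choose k) * of_nat (L choose l) * P (k + l)) =
     (\<Sum>k\<le>Suc K. of_nat (Suc K choose k) * (\<Sum>l\<le>L. of_nat (L choose l) * P (k + l)))"
    by (simp add: sum_distrib_left mult.assoc)
  also have "\<dots> = (\<Sum>k\<le>K. of_nat (K choose k) * ((\<Sum>l\<le>L. of_nat (L choose l) * P (k + l)) + (\<Sum>l\<le>L. of_nat (L choose l) * P (Suc k + l))))"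
    by (rule sum_binomial_Suc)
  also have "\<dots> = (\<Sum>k\<le>K. \<Sum>l\<le>L. of_nat (K choose k) * of_nat (L choose l) * (P (k + l) + P (Suc (k + l))))"
    by (simp add: sum_distrib_left sum.distrib algebra_simps)
  also have "\<dots> = (\<Sum>m\<le>K + L. of_nat ((K + L) choose m) * (P m + P (Suc m)))"
    by (rule Suc.IH)
  also have "\<dots> = (\<Sum>m\<le>Suc K + L. of_nat ((Suc K + L) choose m) * P m)"
    using sum_binomial_Suc[of "K + L" P] by simp
  finally show ?case .
qed simp

text \<open>
The coefficient form of \<open>(1 - x - y)^(-\<delta>) (1 - x - y)^(-\<delta>') = (1 - x - y)^(-\<delta> - \<delta>')\<close>. Summing over
\<open>k + l = m\<close> first leaves the binomial theorem for Pochhammer symbols.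
\<close>
lemma ml_coeff_convolution:
  "(\<Sum>(k, l)\<in>{..K} \<times> {..L}. ml_coeff \<omega>1 \<omega>2 \<delta> (k, l) * ml_coeff \<omega>1 \<omega>2 \<delta>' (K - k, L - l))
     = ml_coeff \<omega>1 \<omega>2 (\<delta> + \<delta>') (K, L)"
proof -
  define P where "P = (\<lambda>m. pochhammer \<delta> m * pochhammer \<delta>' (K + L - m))"
  define W where "W = \<omega>1 ^ K * \<omega>2 ^ L / (fact K * fact L)"
  have t: "ml_coeff \<omega>1 \<omega>2 \<delta> (k, l) * ml_coeff \<omega>1 \<omega>2 \<delta>' (K - k, L - l) =
      W * (of_nat (K choose k) * of_nat (L choose l) * P (k + l))" if "k \<le> K" "l \<le> L" for k l
  proof -
    have 1: "\<omega>1 ^ K = \<omega>1 ^ k * \<omega>1 ^ (K - k)" "\<omega>2 ^ L = \<omega>2 ^ l * \<omega>2 ^ (L - l)"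
      using that by (simp_all flip: power_add)
    have 2: "K - k + (L - l) = K + L - (k + l)" using that by simp
    show ?thesis
      unfolding ml_coeff_def P_def W_def prod.case 1 2
      using that by (simp add: binomial_fact mult_ac)
  qed
  have "(\<Sum>(k, l)\<in>{..K} \<times> {..L}. ml_coeff \<omega>1 \<omega>2 \<delta> (k, l) * ml_coeff \<omega>1 \<omega>2 \<delta>' (K - k, L - l)) =
      (\<Sum>(k, l)\<in>{..K} \<times> {..L}. W * (of_nat (K choose k) * of_nat (L choose l) * P (k + l)))"
    by (intro sum.cong) (auto simp: t)
  also have "\<dots> = W * (\<Sum>k\<le>K. \<Sum>l\<le>L. of_nat (K choose k) * of_nat (L choose l) * P (k + l))"
    by (simp add: sum.cartesian_product[symmetric] sum_distrib_left)
  also have "\<dots> = W * pochhammer (\<delta> + \<delta>') (K + L)"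
    unfolding sum_vandermonde pochhammer_binomial_sum by (simp add: P_def mult.assoc)
  also have "\<dots> = ml_coeff \<omega>1 \<omega>2 (\<delta> + \<delta>') (K, L)"
    by (simp add: W_def ml_coeff_def)
  finally show ?thesis .
qed

section \<open>The Mittag-Leffler kernels form a convolution semigroup\<close>

text \<open>
The parameters shared by all operators that are composed with each other; \<open>\<gamma>\<close> and \<open>\<delta>\<close> vary.
\<close>
locale ml_parameters =
  fixes \<alpha> \<beta> \<omega>1 \<omega>2 :: complex
  assumes \<alpha>: "Re \<alpha> > 0" and \<beta>: "Re \<beta> > 0"
begin

definition ml_kernel_term :: "complex \<Rightarrow> complex \<Rightarrow> nat \<times> nat \<Rightarrow> real \<Rightarrow> complex" where
  "ml_kernel_term \<gamma> \<delta> p t = ml_coeff \<omega>1 \<omega>2 \<delta> p * rl_kernel (ml_exponent \<alpha> \<beta> \<gamma> p) t"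

definition ml_kernel :: "complex \<Rightarrow> complex \<Rightarrow> real \<Rightarrow> complex" where
  "ml_kernel \<gamma> \<delta> t = (if t > 0 then of_real t powr (\<gamma> - 1) *
     mittag_leffler2 \<alpha> \<beta> \<gamma> \<delta> (\<omega>1 * of_real t powr \<alpha>) (\<omega>2 * of_real t powr \<beta>) else 0)"

lemma ml_kernel_nonpos [simp]: "t \<le> 0 \<Longrightarrow> ml_kernel \<gamma> \<delta> t = 0"
  by (simp add: ml_kernel_def)

lemma ml_kernel_term_nonpos [simp]: "t \<le> 0 \<Longrightarrow> ml_kernel_term \<gamma> \<delta> p t = 0"
  by (simp add: ml_kernel_term_def)

lemma measurable_ml_kernel_term [measurable]: "ml_kernel_term \<gamma> \<delta> p \<in> borel_measurable borel"
  unfolding ml_kernel_term_def[abs_def] by measurable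

lemma Re_ml_exponent_ge: "Re \<gamma> \<le> Re (ml_exponent \<alpha> \<beta> \<gamma> p)"
  using \<alpha> \<beta> by (cases p) (simp add: ml_exponent_def)

text \<open>
All exponents have real part at least \<open>Re \<gamma>\<close>, so on \<open>(0, T]\<close> every term is dominated by the same
integrable power of \<open>t\<close>, with summable constants \<open>U\<close>.
\<close>
lemma ml_kernel_term_bound:
  assumes \<gamma>: "Re \<gamma> > 0" and T: "T > 0"
  obtains U where "U summable_on UNIV" "\<And>p. U p \<ge> 0"
    "\<And>p t. t \<le> T \<Longrightarrow> norm (ml_kernel_term \<gamma> \<delta> p t) \<le> U p * rpower (Re \<gamma>) t"
proof -
  define U where "U = (\<lambda>p. norm (ml_coeff \<omega>1 \<omega>2 \<delta> p * rGamma (ml_exponent \<alpha> \<beta> \<gamma> p) *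
           of_real (T powr Re (ml_exponent \<alpha> \<beta> \<gamma> p))) * T powr (- Re \<gamma>))"
  have "U summable_on UNIV"
    unfolding U_def by (intro summable_on_cmult_left ml_coeff_rGamma_abs_summable \<alpha> \<beta> \<gamma> T)
  moreover have "U p \<ge> 0" for p by (simp add: U_def)
  moreover have "norm (ml_kernel_term \<gamma> \<delta> p t) \<le> U p * rpower (Re \<gamma>) t" if t: "t \<le> T" for p t
  proof (cases "t > 0")
    case True
    define x where "x = Re (ml_exponent \<alpha> \<beta> \<gamma> p)"
    define c where "c = norm (ml_coeff \<omega>1 \<omega>2 \<delta> p * rGamma (ml_exponent \<alpha> \<beta> \<gamma> p))"
    have x: "x \<ge> Re \<gamma>" unfolding x_def by (rule Re_ml_exponent_ge)
    have "t powr (x - 1) = t powr (x - Re \<gamma>) * t powr (Re \<gamma> - 1)" by (simp flip: powr_add)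
    also have "\<dots> \<le> T powr (x - Re \<gamma>) * t powr (Re \<gamma> - 1)"
      using t True x by (intro mult_right_mono powr_mono2) auto
    also have "\<dots> = T powr x * T powr (- Re \<gamma>) * t powr (Re \<gamma> - 1)" by (simp flip: powr_add)
    finally have "c * t powr (x - 1) \<le> c * (T powr x * T powr (- Re \<gamma>) * t powr (Re \<gamma> - 1))"
      by (intro mult_left_mono) (auto simp: c_def)
    moreover have "norm (ml_kernel_term \<gamma> \<delta> p t) = c * t powr (x - 1)"
      using True by (simp add: ml_kernel_term_def rl_kernel_def norm_mult norm_cpower rpower_def c_def x_def)
    moreover have "U p * rpower (Re \<gamma>) t = c * (T powr x * T powr (- Re \<gamma>) * t powr (Re \<gamma> - 1))"
      using True by (simp add: U_def c_def x_def rpower_def norm_mult)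
    ultimately show ?thesis by simp
  qed (simp add: rpower_def)
  ultimately show ?thesis by (rule that)
qed

lemma ml_kernel_term_abs_summable:
  assumes \<gamma>: "Re \<gamma> > 0"
  shows "(\<lambda>p. norm (ml_kernel_term \<gamma> \<delta> p t)) summable_on UNIV"
proof -
  have "max t 1 > 0" by simp
  then obtain U where U: "U summable_on UNIV" "\<And>p. U p \<ge> 0"
    "\<And>p s. s \<le> max t 1 \<Longrightarrow> norm (ml_kernel_term \<gamma> \<delta> p s) \<le> U p * rpower (Re \<gamma>) s"
    using ml_kernel_term_bound[OF \<gamma>, of "max t 1" \<delta>] by metis
  have "(\<lambda>p. U p * rpower (Re \<gamma>) t) summable_on UNIV" by (intro summable_on_cmult_left U)
  then show ?thesis
    by (rule summable_on_comparison_test) (use U in auto)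
qed

text \<open>
Absolute convergence allows the iterated series in the definition of the Mittag-Leffler function to
be treated as an unordered sum over pairs.
\<close>
lemma ml_kernel_has_sum:
  assumes \<gamma>: "Re \<gamma> > 0"
  shows "((\<lambda>p. ml_kernel_term \<gamma> \<delta> p t) has_sum ml_kernel \<gamma> \<delta> t) UNIV"
proof (cases "t > 0")
  case False
  then show ?thesis by simp
next
  case True
  define x y where "x = \<omega>1 * of_real t powr \<alpha>" and "y = \<omega>2 * of_real t powr \<beta>"
  have tm: "ml_kernel_term \<gamma> \<delta> (k, l) t = of_real t powr (\<gamma> - 1) * (pochhammer \<delta> (k + l) / Gamma (\<alpha> * of_nat k + \<beta> * of_nat l + \<gamma>)
                 * (x ^ k * y ^ l / (fact k * fact l)))" for k l
  proof -
    have "(of_real t powr \<alpha>) ^ k = exp (of_nat k * (\<alpha> * of_real (ln t)))"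
         "(of_real t powr \<beta>) ^ l = exp (of_nat l * (\<beta> * of_real (ln t)))"
         "of_real t powr (\<gamma> - 1) = exp ((\<gamma> - 1) * of_real (ln t))"
      using True by (simp_all add: powr_def Ln_of_real exp_of_nat_mult)
    then have "cpower (ml_exponent \<alpha> \<beta> \<gamma> (k, l)) t = of_real t powr (\<gamma> - 1) * ((of_real t powr \<alpha>) ^ k * (of_real t powr \<beta>) ^ l)"
      using True by (simp add: cpower_pos ml_exponent_def mult_exp_exp) (simp add: algebra_simps)
    then show ?thesis
      by (simp add: ml_kernel_term_def rl_kernel_def ml_coeff_def x_def y_def power_mult_distrib
          ml_exponent_def rGamma_inverse_Gamma divide_inverse)
  qed
  have infsum_suminf: "infsum f UNIV = suminf f" if "f summable_on UNIV" for f :: "nat \<Rightarrow> complex"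
    using has_sum_imp_sums[OF has_sum_infsum[OF that]] by (simp add: sums_iff)
  have sm: "(\<lambda>p. ml_kernel_term \<gamma> \<delta> p t) summable_on UNIV"
    by (rule abs_summable_summable[OF ml_kernel_term_abs_summable[OF \<gamma>]])
  then have sm': "(\<lambda>(k, l). ml_kernel_term \<gamma> \<delta> (k, l) t) summable_on UNIV \<times> UNIV"
    by (simp add: case_prod_unfold)
  have row: "(\<lambda>l. ml_kernel_term \<gamma> \<delta> (k, l) t) summable_on UNIV" for k
    using summable_on_SigmaD1[OF sm', of k] by simp
  have "(\<Sum>\<^sub>\<infinity>p. ml_kernel_term \<gamma> \<delta> p t) = (\<Sum>\<^sub>\<infinity>k. \<Sum>\<^sub>\<infinity>l. ml_kernel_term \<gamma> \<delta> (k, l) t)"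
    using infsum_Sigma'_banach[OF sm'] by (simp add: case_prod_unfold)
  also have "\<dots> = (\<Sum>k. \<Sum>l. ml_kernel_term \<gamma> \<delta> (k, l) t)"
    using infsum_suminf[OF summable_on_Sigma_banach[OF sm']] by (simp add: infsum_suminf[OF row])
  also have "\<dots> = ml_kernel \<gamma> \<delta> t"
  proof -
    have nz: "of_real t powr (\<gamma> - 1) \<noteq> (0 :: complex)" using True by simp
    have srow: "summable (\<lambda>l. ml_kernel_term \<gamma> \<delta> (k, l) t)" for k
      using has_sum_imp_sums[OF has_sum_infsum[OF row]] by (auto simp: sums_iff)
    have scol: "summable (\<lambda>k. \<Sum>l. ml_kernel_term \<gamma> \<delta> (k, l) t)"
      using has_sum_imp_sums[OF has_sum_infsum[OF summable_on_Sigma_banach[OF sm']]]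
      by (auto simp: sums_iff infsum_suminf[OF row])
    have row_eq: "(\<Sum>l. ml_kernel_term \<gamma> \<delta> (k, l) t) = of_real t powr (\<gamma> - 1) *
        (\<Sum>l. pochhammer \<delta> (k + l) / Gamma (\<alpha> * of_nat k + \<beta> * of_nat l + \<gamma>) * (x ^ k * y ^ l / (fact k * fact l)))" for k
      using srow[of k] nz unfolding tm by (intro suminf_mult) (simp only: summable_mult_D summable_cmult_iff simp_thms)
    show ?thesis
      using scol nz True unfolding row_eq
      by (subst suminf_mult)
         (simp_all only: summable_cmult_iff ml_kernel_def mittag_leffler2_def x_def y_def if_True simp_thms)
  qed
  finally show ?thesis using has_sum_infsum[OF sm] by simp
qed

lemma ml_kernel_infsum: "Re \<gamma> > 0 \<Longrightarrow> (\<Sum>\<^sub>\<infinity>p. ml_kernel_term \<gamma> \<delta> p t) = ml_kernel \<gamma> \<delta> t"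
  by (rule infsumI[OF ml_kernel_has_sum])

lemma measurable_ml_kernel [measurable]: "ml_kernel \<gamma> \<delta> \<in> borel_measurable borel"
proof -
  have eq: "ml_kernel \<gamma> \<delta> = (\<lambda>t. cpower \<gamma> t * mittag_leffler2 \<alpha> \<beta> \<gamma> \<delta> (\<omega>1 * cpower (\<alpha> + 1) t) (\<omega>2 * cpower (\<beta> + 1) t))"
    by (auto simp: fun_eq_iff ml_kernel_def cpower_def)
  show ?thesis unfolding eq mittag_leffler2_def by measurable
qed

lemma ml_kernel_bound:
  assumes \<gamma>: "Re \<gamma> > 0" and T: "T > 0"
  obtains C where "C \<ge> 0" "\<And>t. t \<le> T \<Longrightarrow> norm (ml_kernel \<gamma> \<delta> t) \<le> C * rpower (Re \<gamma>) t"
proof -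
  obtain U where U: "U summable_on UNIV" "\<And>p. U p \<ge> 0"
    "\<And>p t. t \<le> T \<Longrightarrow> norm (ml_kernel_term \<gamma> \<delta> p t) \<le> U p * rpower (Re \<gamma>) t"
    using ml_kernel_term_bound[OF assms] by metis
  have "norm (ml_kernel \<gamma> \<delta> t) \<le> infsum U UNIV * rpower (Re \<gamma>) t" if "t \<le> T" for t
  proof -
    have "ml_kernel \<gamma> \<delta> t = (\<Sum>\<^sub>\<infinity>p. ml_kernel_term \<gamma> \<delta> p t)"
      by (simp add: ml_kernel_infsum \<gamma>)
    also have "norm \<dots> \<le> (\<Sum>\<^sub>\<infinity>p. norm (ml_kernel_term \<gamma> \<delta> p t))"
      by (rule norm_infsum_bound[OF ml_kernel_term_abs_summable[OF \<gamma>]])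
    also have "\<dots> \<le> (\<Sum>\<^sub>\<infinity>p. U p * rpower (Re \<gamma>) t)"
      using U that by (intro infsum_mono ml_kernel_term_abs_summable[OF \<gamma>] summable_on_cmult_left) auto
    also have "\<dots> = infsum U UNIV * rpower (Re \<gamma>) t" by (rule infsum_cmult_left')
    finally show ?thesis .
  qed
  moreover have "infsum U UNIV \<ge> 0" by (intro infsum_nonneg U)
  ultimately show ?thesis using that by blast
qed

text \<open>
Both kernels are expanded, which gives a sum over pairs of index pairs of convolutions of
Riemann-Liouville kernels. The domination of the terms on \<open>(0, T]\<close> justifies integrating termwise. The
terms are then grouped by the sums \<open>K\<close> and \<open>L\<close> of the indices: each group has one common exponent, and its
coefficients add up by \<open>ml_coeff_convolution\<close>.
\<close>
theorem convolution_ml_kernel: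
  assumes \<gamma>: "Re \<gamma> > 0" and \<gamma>': "Re \<gamma>' > 0"
  shows "convolution (ml_kernel \<gamma> \<delta>) (ml_kernel \<gamma>' \<delta>') = ml_kernel (\<gamma> + \<gamma>') (\<delta> + \<delta>')"
proof
  fix t :: real
  define T where "T = max t 1"
  have T: "T > 0" "t \<le> T" by (auto simp: T_def)
  obtain U where U: "U summable_on UNIV" "\<And>p. U p \<ge> 0"
    "\<And>p t. t \<le> T \<Longrightarrow> norm (ml_kernel_term \<gamma> \<delta> p t) \<le> U p * rpower (Re \<gamma>) t"
    using ml_kernel_term_bound[OF \<gamma> T(1)] by metis
  obtain V where V: "V summable_on UNIV" "\<And>p. V p \<ge> 0"
    "\<And>p t. t \<le> T \<Longrightarrow> norm (ml_kernel_term \<gamma>' \<delta>' p t) \<le> V p * rpower (Re \<gamma>') t"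
    using ml_kernel_term_bound[OF \<gamma>' T(1)] by metis
  define f where "f = (\<lambda>(p, q) s. ml_kernel_term \<gamma> \<delta> p (t - s) * ml_kernel_term \<gamma>' \<delta>' q s)"
  define R where "R = (\<lambda>s. rpower (Re \<gamma>) (t - s) * rpower (Re \<gamma>') s)"
  have R: "integrable lborel R" unfolding R_def by (rule integrable_rpower_convolution[OF \<gamma> \<gamma>'])
  have R0: "R s \<ge> 0" for s by (simp add: R_def)
  have fb: "norm (f (p, q) s) \<le> U p * V q * R s" for p q s
  proof (cases "s > 0 \<and> s \<le> t")
    case True
    then have "norm (f (p, q) s) \<le> (U p * rpower (Re \<gamma>) (t - s)) * (V q * rpower (Re \<gamma>') s)"
      unfolding f_def prod.case norm_mult using U V T by (intro mult_mono) auto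
    then show ?thesis by (simp add: R_def mult_ac)
  next
    case False
    then have "f (p, q) s = 0" by (cases "s > 0") (auto simp: f_def)
    then show ?thesis using U V R0 by simp
  qed
  have fm [measurable]: "f pq \<in> borel_measurable borel" for pq
    by (cases pq) (simp add: f_def)
  have fint: "integrable lborel (f pq)" for pq
  proof -
    obtain p q where pq: "pq = (p, q)" by (cases pq)
    have "integrable lborel (\<lambda>s. U p * V q * R s)" using R by simp
    then show ?thesis unfolding pq
      by (rule Bochner_Integration.integrable_bound) (use fb U V R0 in auto)
  qed
  have UV: "(\<lambda>pq. case pq of (p, q) \<Rightarrow> U p * V q) summable_on UNIV"
  proof -
    have "(\<lambda>pq. norm (case pq of (p, q) \<Rightarrow> U p * V q)) summable_on UNIV \<times> UNIV"
      using U V by (intro abs_summable_on_product) auto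
    then show ?thesis by (simp add: abs_summable_summable)
  qed
  have sI: "(\<lambda>pq. LINT s|lborel. norm (f pq s)) summable_on UNIV"
  proof (rule summable_on_comparison_test)
    show "(\<lambda>pq. (case pq of (p, q) \<Rightarrow> U p * V q) * (LINT s|lborel. R s)) summable_on UNIV"
      by (intro summable_on_cmult_left UV)
    fix pq :: "(nat \<times> nat) \<times> nat \<times> nat"
    obtain p q where pq: "pq = (p, q)" by (cases pq)
    have "(LINT s|lborel. norm (f pq s)) \<le> (LINT s|lborel. U p * V q * R s)"
      unfolding pq using fint R fb by (intro integral_mono) auto
    then show "(LINT s|lborel. norm (f pq s)) \<le> (case pq of (p, q) \<Rightarrow> U p * V q) * (LINT s|lborel. R s)"
      by (simp add: pq)
  qed simp
  have ks: "(\<lambda>p. norm (ml_kernel_term \<gamma> \<delta> p s)) summable_on UNIV"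
           "(\<lambda>p. norm (ml_kernel_term \<gamma>' \<delta>' p s)) summable_on UNIV" for s
    by (rule ml_kernel_term_abs_summable[OF \<gamma>] ml_kernel_term_abs_summable[OF \<gamma>'])+
  have fs: "(\<lambda>pq. norm (f pq s)) summable_on UNIV" for s
    using abs_summable_on_product[OF ks(1)[of "t - s"] ks(2)[of s]] by (simp add: f_def case_prod_unfold)
  have "((\<lambda>pq. LINT s|lborel. f pq s) has_sum (LINT s|lborel. (\<Sum>\<^sub>\<infinity>pq. f pq s))) UNIV"
    by (rule has_sum_integral[OF _ fint fs sI]) (simp add: finite_prod)
  moreover have "(\<Sum>\<^sub>\<infinity>pq. f pq s) = ml_kernel \<gamma> \<delta> (t - s) * ml_kernel \<gamma>' \<delta>' s" for s
  proof -
    have "(\<Sum>\<^sub>\<infinity>pq. f pq s) = (\<Sum>\<^sub>\<infinity>p. ml_kernel_term \<gamma> \<delta> p (t - s)) * (\<Sum>\<^sub>\<infinity>q. ml_kernel_term \<gamma>' \<delta>' q s)"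
      using infsum_product_abs_summable[OF ks(1)[of "t - s"] ks(2)[of s]] by (simp add: f_def case_prod_unfold)
    also have "\<dots> = ml_kernel \<gamma> \<delta> (t - s) * ml_kernel \<gamma>' \<delta>' s"
      by (simp add: ml_kernel_infsum \<gamma> \<gamma>')
    finally show ?thesis .
  qed
  ultimately have S: "((\<lambda>pq. LINT s|lborel. f pq s) has_sum convolution (ml_kernel \<gamma> \<delta>) (ml_kernel \<gamma>' \<delta>') t) UNIV"
    by (simp add: convolution_def)
  have fI: "(LINT s|lborel. f (p, q) s) = ml_coeff \<omega>1 \<omega>2 \<delta> p * ml_coeff \<omega>1 \<omega>2 \<delta>' q *
      rl_kernel (ml_exponent \<alpha> \<beta> \<gamma> p + ml_exponent \<alpha> \<beta> \<gamma>' q) t" for p q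
  proof -
    have "Re (ml_exponent \<alpha> \<beta> \<gamma> p) > 0" "Re (ml_exponent \<alpha> \<beta> \<gamma>' q) > 0"
      using Re_ml_exponent_ge[of \<gamma> p] Re_ml_exponent_ge[of \<gamma>' q] \<gamma> \<gamma>' by linarith+
    then have "convolution (rl_kernel (ml_exponent \<alpha> \<beta> \<gamma> p)) (rl_kernel (ml_exponent \<alpha> \<beta> \<gamma>' q)) t =
        rl_kernel (ml_exponent \<alpha> \<beta> \<gamma> p + ml_exponent \<alpha> \<beta> \<gamma>' q) t"
      by (simp add: convolution_rl_kernel)
    moreover have "f (p, q) s = (ml_coeff \<omega>1 \<omega>2 \<delta> p * ml_coeff \<omega>1 \<omega>2 \<delta>' q) *
        (rl_kernel (ml_exponent \<alpha> \<beta> \<gamma> p) (t - s) * rl_kernel (ml_exponent \<alpha> \<beta> \<gamma>' q) s)" for s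
      by (simp add: f_def ml_kernel_term_def)
    ultimately show ?thesis by (simp add: convolution_def)
  qed
  \<comment> \<open>The same family after regrouping: \<open>(K, L)\<close> are the index sums, \<open>(k, l)\<close> the indices of the first factor.\<close>
  define h where "h = (\<lambda>((K :: nat, L :: nat), (k, l)). ml_coeff \<omega>1 \<omega>2 \<delta> (k, l) * ml_coeff \<omega>1 \<omega>2 \<delta>' (K - k, L - l) *
      rl_kernel (ml_exponent \<alpha> \<beta> (\<gamma> + \<gamma>') (K, L)) t)"
  define B where "B = (\<lambda>(K :: nat, L :: nat). {..K} \<times> {..L})"
  have "(h has_sum convolution (ml_kernel \<gamma> \<delta>) (ml_kernel \<gamma>' \<delta>') t) (Sigma UNIV B)
     \<longleftrightarrow> ((\<lambda>pq. LINT s|lborel. f pq s) has_sum convolution (ml_kernel \<gamma> \<delta>) (ml_kernel \<gamma>' \<delta>') t) UNIV"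
  proof (rule has_sum_reindex_bij_witness[where i = "\<lambda>((k, l), (k', l')). ((k + k', l + l'), (k, l))"
        and j = "\<lambda>((K, L), (k, l)). ((k, l), (K - k, L - l))"])
    fix a assume "a \<in> Sigma UNIV B"
    then obtain K L k l where a: "a = ((K, L), (k, l))" "k \<le> K" "l \<le> L"
      by (auto simp: B_def)
    have "ml_exponent \<alpha> \<beta> \<gamma> (k, l) + ml_exponent \<alpha> \<beta> \<gamma>' (K - k, L - l) = ml_exponent \<alpha> \<beta> (\<gamma> + \<gamma>') (K, L)"
      using a by (simp add: ml_exponent_def of_nat_diff algebra_simps)
    then show "(LINT s|lborel. f (case a of (x, y) \<Rightarrow> (case x of (K, L) \<Rightarrow> \<lambda>(k, l). ((k, l), K - k, L - l)) y) s) = h a"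
      by (simp add: a fI h_def)
  qed (auto simp: B_def)
  with S have H: "(h has_sum convolution (ml_kernel \<gamma> \<delta>) (ml_kernel \<gamma>' \<delta>') t) (Sigma UNIV B)" by blast
  have "((\<lambda>p. ml_kernel_term (\<gamma> + \<gamma>') (\<delta> + \<delta>') p t) has_sum convolution (ml_kernel \<gamma> \<delta>) (ml_kernel \<gamma>' \<delta>') t) UNIV"
  proof (rule has_sum_SigmaD[OF H])
    fix p :: "nat \<times> nat"
    obtain K L where p: "p = (K, L)" by (cases p)
    have "(\<Sum>y\<in>B p. h (p, y)) = (\<Sum>(k, l)\<in>{..K} \<times> {..L}. ml_coeff \<omega>1 \<omega>2 \<delta> (k, l) * ml_coeff \<omega>1 \<omega>2 \<delta>' (K - k, L - l)) *
      rl_kernel (ml_exponent \<alpha> \<beta> (\<gamma> + \<gamma>') (K, L)) t"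
      unfolding sum_distrib_right by (intro sum.cong) (auto simp: p B_def h_def)
    also have "\<dots> = ml_kernel_term (\<gamma> + \<gamma>') (\<delta> + \<delta>') p t"
      by (simp add: ml_coeff_convolution ml_kernel_term_def p)
    finally show "((\<lambda>y. h (p, y)) has_sum ml_kernel_term (\<gamma> + \<gamma>') (\<delta> + \<delta>') p t) (B p)"
      by (intro has_sum_finiteI) (auto simp: p B_def)
  qed
  moreover have "Re (\<gamma> + \<gamma>') > 0" using \<gamma> \<gamma>' by simp
  ultimately show "convolution (ml_kernel \<gamma> \<delta>) (ml_kernel \<gamma>' \<delta>') t = ml_kernel (\<gamma> + \<gamma>') (\<delta> + \<delta>') t"
    using ml_kernel_has_sum has_sum_unique by blast
qed

text \<open>
For \<open>\<delta> = 0\<close> only the Pochhammer symbol of order zero survives.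
\<close>
lemma ml_kernel_zero:
  assumes \<gamma>: "Re \<gamma> > 0"
  shows "ml_kernel \<gamma> 0 = rl_kernel \<gamma>"
proof
  fix t
  let ?f = "\<lambda>p. ml_kernel_term \<gamma> 0 p t"
  have "?f p = 0" if "p \<noteq> (0, 0)" for p
    using that by (cases p) (auto simp: ml_kernel_term_def ml_coeff_def pochhammer_0_left)
  moreover have "(?f has_sum ?f (0, 0)) {(0, 0)}"
    by (rule has_sum_finiteI) auto
  ultimately have "(?f has_sum ?f (0, 0)) UNIV"
    using has_sum_cong_neutral[of "{(0, 0)}" UNIV ?f ?f] by auto
  with ml_kernel_has_sum[OF \<gamma>, of 0 t] have "ml_kernel \<gamma> 0 t = ?f (0, 0)"
    by (rule has_sum_unique)
  then show "ml_kernel \<gamma> 0 t = rl_kernel \<gamma> t"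
    by (simp add: ml_kernel_term_def ml_coeff_def ml_exponent_def)
qed

text \<open>
The dominating Beta integral is a multiple of \<open>t\<close> to the power \<open>Re \<gamma> + Re \<gamma>' - 1\<close>, which stays
bounded near \<open>0\<close> exactly because this exponent is nonnegative.
\<close>
lemma ml_kernel_convolution_bounded:
  assumes \<gamma>: "Re \<gamma> > 0" and \<gamma>': "Re \<gamma>' > 0" and ge: "Re \<gamma> + Re \<gamma>' \<ge> 1"
  obtains B where "\<And>t. t < X \<Longrightarrow> (\<integral>\<^sup>+u. norm (ml_kernel \<gamma> \<delta> (t - u) * ml_kernel \<gamma>' \<delta>' u) \<partial>lborel) \<le> ennreal B"
proof -
  define T where "T = max X 1"
  have T: "T > 0" "X \<le> T" by (auto simp: T_def)
  obtain C where C: "C \<ge> 0" "\<And>t. t \<le> T \<Longrightarrow> norm (ml_kernel \<gamma> \<delta> t) \<le> C * rpower (Re \<gamma>) t"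
    using ml_kernel_bound[OF \<gamma> T(1)] by metis
  obtain D where D: "D \<ge> 0" "\<And>t. t \<le> T \<Longrightarrow> norm (ml_kernel \<gamma>' \<delta>' t) \<le> D * rpower (Re \<gamma>') t"
    using ml_kernel_bound[OF \<gamma>' T(1)] by metis
  have "(\<integral>\<^sup>+u. norm (ml_kernel \<gamma> \<delta> (t - u) * ml_kernel \<gamma>' \<delta>' u) \<partial>lborel) \<le>
      ennreal (C * D * (T powr (Re \<gamma> + Re \<gamma>' - 1) * Beta (Re \<gamma>) (Re \<gamma>')))" if t: "t < X" for t
  proof -
    have Bp: "Beta (Re \<gamma>) (Re \<gamma>') \<ge> 0"
      using \<gamma> \<gamma>' by (simp add: Beta_def Gamma_real_pos less_imp_le)
    have b: "norm (ml_kernel \<gamma> \<delta> (t - u) * ml_kernel \<gamma>' \<delta>' u) \<le> (C * D) * (rpower (Re \<gamma>) (t - u) * rpower (Re \<gamma>') u)" for u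
    proof (cases "u > 0 \<and> u < t")
      case True
      then have "norm (ml_kernel \<gamma> \<delta> (t - u) * ml_kernel \<gamma>' \<delta>' u) \<le> (C * rpower (Re \<gamma>) (t - u)) * (D * rpower (Re \<gamma>') u)"
        unfolding norm_mult using C D T t by (intro mult_mono) auto
      then show ?thesis by (simp add: mult_ac)
    next
      case False
      then have "norm (ml_kernel \<gamma> \<delta> (t - u) * ml_kernel \<gamma>' \<delta>' u) = 0" by (cases "u > 0") auto
      moreover have "0 \<le> (C * D) * (rpower (Re \<gamma>) (t - u) * rpower (Re \<gamma>') u)"
        using C(1) D(1) by simp
      ultimately show ?thesis by linarith
    qed
    have "(\<integral>\<^sup>+u. norm (ml_kernel \<gamma> \<delta> (t - u) * ml_kernel \<gamma>' \<delta>' u) \<partial>lborel) \<le>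
       (\<integral>\<^sup>+u. ennreal (C * D) * ennreal (rpower (Re \<gamma>) (t - u) * rpower (Re \<gamma>') u) \<partial>lborel)"
    proof (intro nn_integral_mono)
      fix u
      have "ennreal (norm (ml_kernel \<gamma> \<delta> (t - u) * ml_kernel \<gamma>' \<delta>' u)) \<le> ennreal ((C * D) * (rpower (Re \<gamma>) (t - u) * rpower (Re \<gamma>') u))"
        by (rule ennreal_leI[OF b])
      also have "\<dots> = ennreal (C * D) * ennreal (rpower (Re \<gamma>) (t - u) * rpower (Re \<gamma>') u)"
        using C(1) D(1) by (intro ennreal_mult') simp
      finally show "ennreal (norm (ml_kernel \<gamma> \<delta> (t - u) * ml_kernel \<gamma>' \<delta>' u)) \<le>
        ennreal (C * D) * ennreal (rpower (Re \<gamma>) (t - u) * rpower (Re \<gamma>') u)" .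
    qed
    also have "\<dots> = ennreal (C * D) * (\<integral>\<^sup>+u. ennreal (rpower (Re \<gamma>) (t - u) * rpower (Re \<gamma>') u) \<partial>lborel)"
      by (rule nn_integral_cmult) auto
    also have "\<dots> \<le> ennreal (C * D) * ennreal (T powr (Re \<gamma> + Re \<gamma>' - 1) * Beta (Re \<gamma>) (Re \<gamma>'))"
    proof (intro mult_left_mono)
      show "(\<integral>\<^sup>+u. ennreal (rpower (Re \<gamma>) (t - u) * rpower (Re \<gamma>') u) \<partial>lborel)
         \<le> ennreal (T powr (Re \<gamma> + Re \<gamma>' - 1) * Beta (Re \<gamma>) (Re \<gamma>'))"
      proof (cases "t > 0")
        case True
        then show ?thesis using t T ge Bp
          by (subst nn_integral_rpower_convolution[OF \<gamma> \<gamma>' True])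
             (intro ennreal_leI mult_right_mono powr_mono2; simp)
      next
        case False
        then show ?thesis by (simp add: nn_integral_rpower_convolution_nonpos)
      qed
    qed simp
    also have "\<dots> = ennreal (C * D * (T powr (Re \<gamma> + Re \<gamma>' - 1) * Beta (Re \<gamma>) (Re \<gamma>')))"
      using C(1) D(1) by (simp add: ennreal_mult'[symmetric])
    finally show ?thesis .
  qed
  then show ?thesis by (rule that)
qed

lemma convolution_ml_kernel_assoc:
  assumes g: "integrable lborel g" "\<forall>s\<le>c. g s = 0"
    and \<gamma>: "Re \<gamma> > 0" "Re \<gamma>' > 0" "Re \<gamma> + Re \<gamma>' \<ge> 1"
  shows "convolution (ml_kernel \<gamma> \<delta>) (convolution (ml_kernel \<gamma>' \<delta>') g) x = convolution (ml_kernel (\<gamma> + \<gamma>') (\<delta> + \<delta>')) g x"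
proof -
  obtain B where "\<And>t. t < x - c \<Longrightarrow> (\<integral>\<^sup>+u. norm (ml_kernel \<gamma> \<delta> (t - u) * ml_kernel \<gamma>' \<delta>' u) \<partial>lborel) \<le> ennreal B"
    using ml_kernel_convolution_bounded[OF \<gamma>] by metis
  then have "convolution (ml_kernel \<gamma> \<delta>) (convolution (ml_kernel \<gamma>' \<delta>') g) x =
    convolution (convolution (ml_kernel \<gamma> \<delta>) (ml_kernel \<gamma>' \<delta>')) g x"
    using g by (intro convolution_assoc[where c = c]) auto
  then show ?thesis by (simp add: convolution_ml_kernel \<gamma>)
qed

end

section \<open>Operators as convolutions\<close>

text \<open>
Fubini is applied to Lebesgue measure on Borel sets, so a Lebesgue measurable \<open>f\<close> is
replaced by a Borel function that agrees with it almost everywhere. No operator notices, since each of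
them begins with an integration of \<open>f\<close>.
\<close>
lemma absolutely_integrable_borel_version:
  fixes f :: "real \<Rightarrow> complex"
  assumes f: "f absolutely_integrable_on {c<..<d}"
  obtains g where "integrable lborel g" "\<And>s. s \<notin> {c<..<d} \<Longrightarrow> g s = 0"
    "AE s in lebesgue. s \<in> {c<..<d} \<longrightarrow> f s = g s"
proof -
  define F where "F = (\<lambda>s. indicat_real {c<..<d} s *\<^sub>R f s)"
  have F: "integrable lebesgue F" using f by (simp add: set_integrable_def F_def)
  then have [measurable]: "F \<in> borel_measurable lebesgue" by simp
  have "(\<lambda>s. Re (F s)) \<in> borel_measurable lebesgue" by measurable
  then obtain u where u: "u \<in> borel_measurable lborel" "AE s in lborel. Re (F s) = u s"
    using completion_ex_borel_measurable_real by blast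
  have "(\<lambda>s. Im (F s)) \<in> borel_measurable lebesgue" by measurable
  then obtain v where v: "v \<in> borel_measurable lborel" "AE s in lborel. Im (F s) = v s"
    using completion_ex_borel_measurable_real by blast
  define g where "g = (\<lambda>s. indicat_real {c<..<d} s *\<^sub>R Complex (u s) (v s))"
  have [measurable]: "u \<in> borel_measurable borel" "v \<in> borel_measurable borel" using u v by auto
  have gm [measurable]: "g \<in> borel_measurable borel"
    unfolding g_def Complex_eq by measurable
  have "AE s in lebesgue. Re (F s) = u s" "AE s in lebesgue. Im (F s) = v s"
    using u(2) v(2) by (auto intro: AE_completion)
  then have ae: "AE s in lebesgue. F s = g s"
  proof eventually_elim
    case (elim s)
    then have "g s = indicat_real {c<..<d} s *\<^sub>R F s" by (simp add: g_def complex_eq_iff)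
    then show ?case by (simp add: F_def indicator_def)
  qed
  have gl: "g \<in> borel_measurable lebesgue" by (rule measurable_completion) simp
  have "integrable lebesgue g"
    using integrable_cong_AE[OF _ gl ae] F by simp
  then have "integrable lborel g" by (subst (asm) integrable_completion) auto
  moreover have "AE s in lebesgue. s \<in> {c<..<d} \<longrightarrow> f s = g s"
    using ae by eventually_elim (auto simp: F_def indicator_def)
  ultimately show ?thesis using that[of g] by (simp add: g_def)
qed

text \<open>
The assumption on \<open>f\<close> asks only for measurability on \<open>(c, d)\<close>, because \<open>f\<close> will also be the result
of another integral operator, which is known to be a convolution only up to \<open>d\<close>.
\<close>
lemma set_integral_eq_convolution:
  fixes f g K :: "real \<Rightarrow> complex"
  assumes K: "K \<in> borel_measurable borel" and K0: "\<And>t. t \<le> 0 \<Longrightarrow> K t = 0"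
    and g: "g \<in> borel_measurable borel" and g0: "\<forall>s\<le>c. g s = 0"
    and fm: "(\<lambda>s. indicat_real {c<..<d} s *\<^sub>R f s) \<in> borel_measurable lebesgue"
    and ae: "AE s in lebesgue. s \<in> {c<..<d} \<longrightarrow> f s = g s"
    and x: "x \<le> d"
  shows "(LINT \<xi>:{c<..<x}|lebesgue. K (x - \<xi>) * f \<xi>) = convolution K g x"
proof -
  have [measurable]: "K \<in> borel_measurable borel" "g \<in> borel_measurable borel" by fact+
  have Km: "(\<lambda>\<xi>. K (x - \<xi>)) \<in> borel_measurable lebesgue"
    by (rule measurable_completion) simp
  have "(LINT \<xi>:{c<..<x}|lebesgue. K (x - \<xi>) * f \<xi>) =
     (LINT \<xi>|lebesgue. indicat_real {c<..<x} \<xi> *\<^sub>R (K (x - \<xi>) * (indicat_real {c<..<d} \<xi> *\<^sub>R f \<xi>)))"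
    unfolding set_lebesgue_integral_def using x
    by (intro Bochner_Integration.integral_cong) (auto simp: indicator_def)
  also have "\<dots> = (LINT \<xi>|lebesgue. K (x - \<xi>) * g \<xi>)"
  proof (rule integral_cong_AE)
    show "(\<lambda>\<xi>. indicat_real {c<..<x} \<xi> *\<^sub>R (K (x - \<xi>) * (indicat_real {c<..<d} \<xi> *\<^sub>R f \<xi>))) \<in> borel_measurable lebesgue"
      by (rule borel_measurable_scaleR[OF borel_measurable_indicator borel_measurable_times[OF Km fm]]) simp
    show "(\<lambda>\<xi>. K (x - \<xi>) * g \<xi>) \<in> borel_measurable lebesgue"
      by (rule measurable_completion) simp
    show "AE \<xi> in lebesgue. indicat_real {c<..<x} \<xi> *\<^sub>R (K (x - \<xi>) * (indicat_real {c<..<d} \<xi> *\<^sub>R f \<xi>)) = K (x - \<xi>) * g \<xi>"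
      using ae
    proof eventually_elim
      case (elim \<xi>)
      then show ?case using x g0 K0[of "x - \<xi>"]
        by (cases "\<xi> \<le> c"; cases "\<xi> < x") (auto simp: indicator_def)
    qed
  qed
  also have "\<dots> = convolution K g x"
    unfolding convolution_def by (rule integral_completion) simp
  finally show ?thesis .
qed

lemma rl_kernel_1: "t > 0 \<Longrightarrow> rl_kernel 1 t = 1"
  by (simp add: rl_kernel_def cpower_def)

lemma convolution_rl_kernel_1:
  assumes h: "h absolutely_integrable_on {c<..<x}" "h \<in> borel_measurable borel" "\<And>s. s \<le> c \<Longrightarrow> h s = 0"
  shows "convolution (rl_kernel 1) h x = integral {c..x} h"
proof -
  have "convolution (rl_kernel 1) h x = (LINT s:{c<..<x}|lebesgue. rl_kernel 1 (x - s) * h s)"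
  proof (rule set_integral_eq_convolution[symmetric, where d = x])
    show "(\<lambda>s. indicat_real {c<..<x} s *\<^sub>R h s) \<in> borel_measurable lebesgue"
      using h(1) by (auto simp: set_integrable_def)
  qed (use h in auto)
  also have "\<dots> = (LINT s:{c<..<x}|lebesgue. h s)"
    by (intro set_lebesgue_integral_cong) (auto simp: rl_kernel_1)
  also have "\<dots> = integral {c..x} h"
    using set_lebesgue_integral_eq_integral(2)[OF h(1)] by (simp add: integral_open_interval_real)
  finally show ?thesis .
qed

lemma convolution_rl_kernel_Suc:
  assumes g: "integrable lborel g" "\<forall>s\<le>c. g s = 0" and n: "n \<ge> 1"
  shows "convolution (rl_kernel 1) (convolution (rl_kernel (of_nat n)) g) x = convolution (rl_kernel (of_nat (Suc n))) g x"
proof -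
  \<comment> \<open>The power kernels are the Mittag-Leffler kernels with \<open>\<delta> = 0\<close>, for any choice of the other parameters.\<close>
  interpret ml_parameters 1 1 0 0 by unfold_locales simp_all
  have p: "Re 1 > 0" "Re (of_nat n) > 0" "Re 1 + Re (of_nat n) \<ge> 1" "Re (1 + of_nat n) > 0"
    using n by simp_all
  show ?thesis
    using convolution_ml_kernel_assoc[OF g p(1-3), of 0 0 x] by (simp only: ml_kernel_zero p add_0_right of_nat_Suc)
qed

lemma iterated_integral_eq_convolution:
  assumes g: "integrable lborel g" "\<forall>s\<le>c. g s = 0"
    and fm: "(\<lambda>s. indicat_real {c<..<d} s *\<^sub>R f s) \<in> borel_measurable lebesgue"
    and ae: "AE s in lebesgue. s \<in> {c<..<d} \<longrightarrow> f s = g s"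
    and n: "n \<ge> 1" and x: "x \<le> d"
  shows "iterated_integral c n f x = convolution (rl_kernel (of_nat n)) g x"
  using n x
proof (induction n arbitrary: x rule: nat_induct_at_least)
  case base
  have [measurable]: "g \<in> borel_measurable borel" using g by auto
  have "iterated_integral c 1 f x = (LINT s:{c<..<x}|lebesgue. rl_kernel 1 (x - s) * f s)"
    by (simp add: iterated_integral_def) (intro set_lebesgue_integral_cong; auto simp: rl_kernel_1)
  also have "\<dots> = convolution (rl_kernel 1) g x"
    using g fm ae base by (intro set_integral_eq_convolution) auto
  finally show ?case by simp
next
  case (Suc n)
  have [measurable]: "g \<in> borel_measurable borel" using g by auto
  define h where "h = convolution (rl_kernel (of_nat n)) g"
  have [measurable]: "h \<in> borel_measurable borel" unfolding h_def by measurable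
  have h0: "h s = 0" if "s \<le> c" for s
    unfolding h_def by (rule convolution_vanish[OF _ g(2) that]) auto
  have "iterated_integral c (Suc n) f x = (LINT s:{c<..<x}|lebesgue. rl_kernel 1 (x - s) * h s)"
    unfolding iterated_integral_Suc
    by (intro set_lebesgue_integral_cong) (use Suc in \<open>auto simp: rl_kernel_1 h_def\<close>)
  also have "\<dots> = convolution (rl_kernel 1) h x"
  proof (rule set_integral_eq_convolution[where d = x])
    show "(\<lambda>s. indicat_real {c<..<x} s *\<^sub>R h s) \<in> borel_measurable lebesgue"
      by (rule measurable_completion) simp
  qed (use h0 in auto)
  also have "\<dots> = convolution (rl_kernel (of_nat (Suc n))) g x"
    unfolding h_def using Suc by (intro convolution_rl_kernel_Suc[OF g]) auto
  finally show ?case .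
qed

text \<open>
Write \<open>P m\<close> for the m-fold integral of \<open>g\<close>. From \<open>m = 1\<close> on it is continuous, so \<open>P (m + 1)\<close> has
the derivative \<open>P m\<close> everywhere, and the first \<open>n - 1\<close> derivatives of \<open>P n\<close> lead down to
\<open>P 1\<close>. Only the last step, from \<open>P 1\<close> to \<open>g\<close>, is an almost everywhere statement.
\<close>
lemma nth_deriv_convolution_rl_kernel:
  assumes g: "integrable lborel g" "\<forall>s\<le>c. g s = 0" and n: "n \<ge> 1"
    and G: "\<And>x. x \<in> {c<..<d} \<Longrightarrow> G x = convolution (rl_kernel (of_nat n)) g x"
  shows "AE x in lebesgue. x \<in> {c<..<d} \<longrightarrow> nth_differentiable_at n G x \<and> nth_deriv n G x = g x"
proof -
  have [measurable]: "g \<in> borel_measurable borel" using g by auto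
  define P where "P = (\<lambda>m. convolution (rl_kernel (of_nat m)) g)"
  have Pm [measurable]: "P m \<in> borel_measurable borel" for m unfolding P_def by measurable
  have P0: "P m s = 0" if "s \<le> c" for m s
    unfolding P_def by (rule convolution_vanish[OF _ g(2) that]) auto
  have "integrable lebesgue g" using g by (subst integrable_completion) auto
  then have ag: "g absolutely_integrable_on S" if "S \<in> sets lebesgue" for S
    using that set_integrable_subset[of lebesgue UNIV g S] by (simp add: set_integrable_def)
  have P1: "P 1 x = integral {c..x} g" for x
    unfolding P_def using convolution_rl_kernel_1[where h = g and c = c and x = x] ag g(2) by simp
  then have P1f: "P 1 = (\<lambda>x. integral {c..x} g)" by blast
  have gi: "g integrable_on {c..d}"
    by (rule set_lebesgue_integral_eq_integral(1)[OF ag]) simp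
  have step: "P (Suc m) x = integral {c..x} (P m)" if "m \<ge> 1" "continuous_on {c..d} (P m)" "x \<le> d" for m x
  proof -
    have "continuous_on {c..x} (P m)" using that by (auto intro: continuous_on_subset)
    then have "P m absolutely_integrable_on {c<..<x}"
      unfolding absolutely_integrable_on_Icc_iff_Ioo[symmetric] by (rule absolutely_integrable_continuous_real)
    then have "convolution (rl_kernel 1) (P m) x = integral {c..x} (P m)"
      by (rule convolution_rl_kernel_1) (use P0 in auto)
    moreover have "convolution (rl_kernel 1) (P m) x = P (Suc m) x"
      unfolding P_def by (rule convolution_rl_kernel_Suc[OF g that(1)])
    ultimately show ?thesis by simp
  qed
  have cont: "continuous_on {c..d} (P m)" if "m \<ge> 1" for m
    using that
  proof (induction m rule: nat_induct_at_least)
    case base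
    show ?case unfolding P1f by (rule indefinite_integral_continuous_1[OF gi])
  next
    case (Suc m)
    have "continuous_on {c..d} (\<lambda>x. integral {c..x} (P m))"
      using Suc by (intro indefinite_integral_continuous_1 integrable_continuous_real) auto
    then show ?case
      by (rule continuous_on_cong[THEN iffD1, rotated -1]) (use step Suc in auto)
  qed
  have der: "(P (Suc m) has_vector_derivative P m x) (at x)" if "m \<ge> 1" "x \<in> {c<..<d}" for m x
  proof -
    have "((\<lambda>u. integral {c..u} (P m)) has_vector_derivative P m x) (at x within {c..d})"
      using that cont by (intro integral_has_vector_derivative) auto
    then have "((\<lambda>u. integral {c..u} (P m)) has_vector_derivative P m x) (at x)"
      using that by (simp add: at_within_Icc_at)
    then show ?thesis
      by (rule has_vector_derivative_transform_within_open[where S = "{c<..<d}"]) (use that step cont in auto)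
  qed
  define N where "N = n - 1"
  have N: "n = Suc N" using n by (simp add: N_def)
  have chain: "nth_differentiable_at N G x \<and> nth_deriv N G x = P 1 x" if "x \<in> {c<..<d}" for x
  proof -
    have "(P (n - k) has_vector_derivative P (n - Suc k) y) (at y)" if "k < N" "y \<in> {c<..<d}" for k y
      using der[of "n - Suc k" y] that by (simp add: N Suc_diff_le Suc_diff_Suc)
    then have "nth_differentiable_at N G x \<and> nth_deriv N G x = P (n - N) x"
      using that by (intro nth_deriv_chain[where P = "\<lambda>k. P (n - k)" and S = "{c<..<d}" and m = N]) (auto simp: G P_def)
    then show ?thesis by (simp add: N)
  qed
  let ?E = "{x \<in> {c<..<d}. \<not> ((\<lambda>t. integral {c..t} g) has_vector_derivative g x) (at x)}"
  have "AE x in lebesgue. x \<notin> ?E"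
    using indefinite_integral_has_vector_derivative_ae[OF gi]
    by (intro AE_not_in) (simp add: negligible_iff_null_sets)
  then show ?thesis
  proof eventually_elim
    case (elim x)
    show ?case
    proof
      assume x: "x \<in> {c<..<d}"
      with elim have "(P 1 has_vector_derivative g x) (at x)" unfolding P1f by blast
      then have D: "(nth_deriv N G has_vector_derivative g x) (at x)"
        by (rule has_vector_derivative_transform_within_open[where S = "{c<..<d}"]) (use x chain in auto)
      have "\<forall>\<^sub>F t in nhds x. nth_differentiable_at N G t"
        using eventually_nhds_in_open[OF open_greaterThanLessThan x]
        by eventually_elim (use chain in auto)
      then show "nth_differentiable_at n G x \<and> nth_deriv n G x = g x"
        using D by (auto simp: N nth_deriv_Suc differentiableI_vector vector_derivative_at)
    qed
  qed
qed

context ml_parameters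
begin

lemma ml_integral_eq_convolution:
  assumes g: "g \<in> borel_measurable borel" "\<forall>s\<le>c. g s = 0"
    and fm: "(\<lambda>s. indicat_real {c<..<d} s *\<^sub>R f s) \<in> borel_measurable lebesgue"
    and ae: "AE s in lebesgue. s \<in> {c<..<d} \<longrightarrow> f s = g s"
    and x: "x \<le> d"
  shows "ml_integral c \<alpha> \<beta> \<gamma> \<delta> \<omega>1 \<omega>2 f x = convolution (ml_kernel \<gamma> \<delta>) g x"
proof -
  have "ml_integral c \<alpha> \<beta> \<gamma> \<delta> \<omega>1 \<omega>2 f x = (LINT \<xi>:{c<..<x}|lebesgue. ml_kernel \<gamma> \<delta> (x - \<xi>) * f \<xi>)"
    unfolding ml_integral_def by (intro set_lebesgue_integral_cong) (auto simp: ml_kernel_def)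
  also have "\<dots> = convolution (ml_kernel \<gamma> \<delta>) g x"
    by (rule set_integral_eq_convolution[OF _ _ g fm ae x]) auto
  finally show ?thesis .
qed

text \<open>
The composition law of the operators. It holds at every point of the interval, although the inner
integral may diverge at some of them.
\<close>
lemma ml_integral_ml_integral:
  assumes g: "integrable lborel g" "\<forall>s\<le>c. g s = 0"
    and fm: "(\<lambda>s. indicat_real {c<..<d} s *\<^sub>R f s) \<in> borel_measurable lebesgue"
    and ae: "AE s in lebesgue. s \<in> {c<..<d} \<longrightarrow> f s = g s"
    and x: "x \<le> d" and \<gamma>: "Re \<gamma> > 0" "Re \<gamma>' > 0" "Re \<gamma> + Re \<gamma>' \<ge> 1"
  shows "ml_integral c \<alpha> \<beta> \<gamma> \<delta> \<omega>1 \<omega>2 (ml_integral c \<alpha> \<beta> \<gamma>' \<delta>' \<omega>1 \<omega>2 f) x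
     = convolution (ml_kernel (\<gamma> + \<gamma>') (\<delta> + \<delta>')) g x"
proof -
  have [measurable]: "g \<in> borel_measurable borel" using g by auto
  define h where "h = convolution (ml_kernel \<gamma>' \<delta>') g"
  have hm [measurable]: "h \<in> borel_measurable borel" unfolding h_def by measurable
  have eq: "ml_integral c \<alpha> \<beta> \<gamma>' \<delta>' \<omega>1 \<omega>2 f s = h s" if "s \<le> d" for s
    unfolding h_def using g fm ae that by (intro ml_integral_eq_convolution) auto
  have "ml_integral c \<alpha> \<beta> \<gamma> \<delta> \<omega>1 \<omega>2 (ml_integral c \<alpha> \<beta> \<gamma>' \<delta>' \<omega>1 \<omega>2 f) x = convolution (ml_kernel \<gamma> \<delta>) h x"
  proof (rule ml_integral_eq_convolution[where d = d])
    show "\<forall>s\<le>c. h s = 0"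
      unfolding h_def using convolution_vanish[OF _ g(2)] by auto
    have "(\<lambda>s. indicat_real {c<..<d} s *\<^sub>R ml_integral c \<alpha> \<beta> \<gamma>' \<delta>' \<omega>1 \<omega>2 f s) = (\<lambda>s. indicat_real {c<..<d} s *\<^sub>R h s)"
      using eq by (auto simp: fun_eq_iff indicator_def)
    also have "\<dots> \<in> borel_measurable lebesgue"
      by (rule measurable_completion) simp
    finally show "(\<lambda>s. indicat_real {c<..<d} s *\<^sub>R ml_integral c \<alpha> \<beta> \<gamma>' \<delta>' \<omega>1 \<omega>2 f s) \<in> borel_measurable lebesgue" .
  qed (use eq x in auto)
  then show ?thesis by (simp only: h_def convolution_ml_kernel_assoc[OF g \<gamma>])
qed

end

section \<open>Both inversion formulas\<close>

text \<open>
In both parts the two kernels combine to the kernel of n-fold integration; the order of the two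
factors is the only difference. Since \<open>n - 1 \<le> Re \<gamma> < n\<close>, both \<open>\<gamma>\<close> and \<open>n - \<gamma>\<close> have positive
real part.
\<close>
theorem theorem3p10:
  fixes c d :: real and \<alpha> \<beta> \<gamma> \<delta> \<omega>1 \<omega>2 :: complex and n :: nat
  assumes "c < d"
    and "Re \<alpha> > 0" and "Re \<beta> > 0" and "Re \<gamma> > 0"
    and "n = frac_order \<gamma>"
  shows
    "(\<forall>f :: real \<Rightarrow> complex. f absolutely_integrable_on {c<..<d} \<longrightarrow>
        (AE x in lebesgue. x \<in> {c<..<d} \<longrightarrow>
           ml_deriv_RL_exists c \<alpha> \<beta> \<gamma> \<delta> \<omega>1 \<omega>2 (ml_integral c \<alpha> \<beta> \<gamma> \<delta> \<omega>1 \<omega>2 f) x \<and>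
           ml_deriv_RL c \<alpha> \<beta> \<gamma> \<delta> \<omega>1 \<omega>2 (ml_integral c \<alpha> \<beta> \<gamma> \<delta> \<omega>1 \<omega>2 f) x = f x))
     \<and>
     (\<forall>f :: real \<Rightarrow> complex.
        C_n_on n f {c<..<d} \<and> nth_deriv n f absolutely_integrable_on {c<..<d} \<longrightarrow>
        (\<forall>k<n. \<exists>L. (nth_deriv k f \<longlongrightarrow> L) (at_right c)) \<and>
        (\<forall>x\<in>{c<..<d}.
           ml_integral c \<alpha> \<beta> \<gamma> \<delta> \<omega>1 \<omega>2 (ml_deriv_Caputo c \<alpha> \<beta> \<gamma> \<delta> \<omega>1 \<omega>2 f) x
             = iterated_integral c n (nth_deriv n f) x \<and>
           iterated_integral c n (nth_deriv n f) x
             = f x - (\<Sum>k<n. of_real ((x - c) ^ k) * Lim (at_right c) (nth_deriv k f) / fact k)))"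
proof (intro conjI allI impI)
  interpret ml_parameters \<alpha> \<beta> \<omega>1 \<omega>2 by unfold_locales fact+
  have n: "n \<ge> 1" "Re \<gamma> < real n"
    using \<open>Re \<gamma> > 0\<close> unfolding \<open>n = frac_order \<gamma>\<close> frac_order_def by linarith+
  have \<gamma>: "Re \<gamma> > 0" "Re (of_nat n - \<gamma>) > 0" "Re (of_nat n - \<gamma>) + Re \<gamma> \<ge> 1" "Re \<gamma> + Re (of_nat n - \<gamma>) \<ge> 1"
    using n \<open>Re \<gamma> > 0\<close> by simp_all
  have kn: "ml_kernel (of_nat n) 0 = rl_kernel (of_nat n)" using n by (simp add: ml_kernel_zero)
  {
    fix f :: "real \<Rightarrow> complex"
    assume f: "f absolutely_integrable_on {c<..<d}"
    obtain g where g: "integrable lborel g" "\<And>s. s \<notin> {c<..<d} \<Longrightarrow> g s = 0"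
        "AE s in lebesgue. s \<in> {c<..<d} \<longrightarrow> f s = g s"
      using absolutely_integrable_borel_version[OF f] by blast
    have fm: "(\<lambda>s. indicat_real {c<..<d} s *\<^sub>R f s) \<in> borel_measurable lebesgue"
      using f by (auto simp: set_integrable_def)
    define G where "G = ml_integral c \<alpha> \<beta> (of_nat n - \<gamma>) (- \<delta>) \<omega>1 \<omega>2 (ml_integral c \<alpha> \<beta> \<gamma> \<delta> \<omega>1 \<omega>2 f)"
    have g0: "\<forall>s\<le>c. g s = 0" using g(2) by auto
    have "G x = convolution (rl_kernel (of_nat n)) g x" if "x \<in> {c<..<d}" for x
      using ml_integral_ml_integral[OF g(1) g0 fm g(3) _ \<gamma>(2,1,3), of x "- \<delta>" \<delta>] that
      by (simp add: G_def kn)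
    then have "AE x in lebesgue. x \<in> {c<..<d} \<longrightarrow> nth_differentiable_at n G x \<and> nth_deriv n G x = g x"
      using g(1) g0 n by (intro nth_deriv_convolution_rl_kernel) auto
    with g(3) show "AE x in lebesgue. x \<in> {c<..<d} \<longrightarrow>
           ml_deriv_RL_exists c \<alpha> \<beta> \<gamma> \<delta> \<omega>1 \<omega>2 (ml_integral c \<alpha> \<beta> \<gamma> \<delta> \<omega>1 \<omega>2 f) x \<and>
           ml_deriv_RL c \<alpha> \<beta> \<gamma> \<delta> \<omega>1 \<omega>2 (ml_integral c \<alpha> \<beta> \<gamma> \<delta> \<omega>1 \<omega>2 f) x = f x"
      unfolding ml_deriv_RL_exists_def ml_deriv_RL_def \<open>n = frac_order \<gamma>\<close>[symmetric] G_def
      by eventually_elim auto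
  next
    fix f :: "real \<Rightarrow> complex"
    assume f: "C_n_on n f {c<..<d} \<and> nth_deriv n f absolutely_integrable_on {c<..<d}"
    then have diff: "\<And>x. x \<in> {c<..<d} \<Longrightarrow> nth_differentiable_at n f x"
      and int: "nth_deriv n f absolutely_integrable_on {c<..<d}"
      by (auto simp: C_n_on_def)
    show "\<exists>L. (nth_deriv k f \<longlongrightarrow> L) (at_right c)" if "k < n" for k
      by (rule iterated_integral_nth_deriv(1)[OF \<open>c < d\<close> diff int that])
    show "\<forall>x\<in>{c<..<d}.
           ml_integral c \<alpha> \<beta> \<gamma> \<delta> \<omega>1 \<omega>2 (ml_deriv_Caputo c \<alpha> \<beta> \<gamma> \<delta> \<omega>1 \<omega>2 f) x
             = iterated_integral c n (nth_deriv n f) x \<and>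
           iterated_integral c n (nth_deriv n f) x
             = f x - (\<Sum>k<n. of_real ((x - c) ^ k) * Lim (at_right c) (nth_deriv k f) / fact k)"
    proof (intro ballI conjI)
      fix x assume x: "x \<in> {c<..<d}"
      obtain g where g: "integrable lborel g" "\<And>s. s \<notin> {c<..<d} \<Longrightarrow> g s = 0"
          "AE s in lebesgue. s \<in> {c<..<d} \<longrightarrow> nth_deriv n f s = g s"
        using absolutely_integrable_borel_version[OF int] by blast
      have fm: "(\<lambda>s. indicat_real {c<..<d} s *\<^sub>R nth_deriv n f s) \<in> borel_measurable lebesgue"
        using int by (auto simp: set_integrable_def)
      have g0: "\<forall>s\<le>c. g s = 0" using g(2) by auto
      have "ml_integral c \<alpha> \<beta> \<gamma> \<delta> \<omega>1 \<omega>2 (ml_deriv_Caputo c \<alpha> \<beta> \<gamma> \<delta> \<omega>1 \<omega>2 f) x = convolution (rl_kernel (of_nat n)) g x"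
        using ml_integral_ml_integral[OF g(1) g0 fm g(3) _ \<gamma>(1,2,4), of x \<delta> "- \<delta>"] x
        by (simp add: ml_deriv_Caputo_def \<open>n = frac_order \<gamma>\<close>[symmetric] kn)
      also have "\<dots> = iterated_integral c n (nth_deriv n f) x"
        using x by (intro iterated_integral_eq_convolution[symmetric, OF g(1) g0 fm g(3) n(1)]) auto
      finally show "ml_integral c \<alpha> \<beta> \<gamma> \<delta> \<omega>1 \<omega>2 (ml_deriv_Caputo c \<alpha> \<beta> \<gamma> \<delta> \<omega>1 \<omega>2 f) x
             = iterated_integral c n (nth_deriv n f) x" .
      show "iterated_integral c n (nth_deriv n f) x
             = f x - (\<Sum>k<n. of_real ((x - c) ^ k) * Lim (at_right c) (nth_deriv k f) / fact k)"
        by (rule iterated_integral_nth_deriv(2)[OF \<open>c < d\<close> diff int x])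
    qed
  }
qed

end
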